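(* Let $\mathbb K$ be a field of characteristic zero and let $\mathfrak m_0$ be the Lie algebra over $\mathbb K$ with basis $e_1,e_2,e_3,\dots$ and brackets $[e_1,e_i]=e_{i+1}$ for $i\ge 2$ (all other brackets of basis elements being zero). Then the cohomology algebra $H^*(\mathfrak m_0)$ is generated with respect to non-trivial Massey products by $H^1(\mathfrak m_0)=\mathrm{Span}([e^1],[e^2])$. Namely, the following hold, and the products occurring in them are non-trivial: (1) for all $q\ge 2$ and $2<i_2<\dots<i_q$, $$\omega(e^{2}\wedge e^{i_2}\wedge\dots\wedge e^{i_q}\wedge e^{i_q+1})=e^{2}\wedge\omega(e^{i_2}\wedge\dots\wedge e^{i_q}\wedge e^{i_q+1});$$ (2) for all $k\ge 2$, the Massey product below is defined, does not contain $0$, and $$2\,[\omega(e^{k}\wedge e^{k+1})]\in\langle e^2,\underbrace{e^1,\dots,e^1}_{2k-3},e^2\rangle;$$ (3) for all $q\ge 2$ and $2\le i_1<i_2<\dots<i_q$, the Massey product below is defined, does not contain $0$, and $$(-1)^{i_1}[\omega(e^{i_1}\wedge e^{i_2}\wedge\dots\wedge e^{i_q}\wedge e^{i_q+1})]\in\langle e^2,\underbrace{e^1,\dots,e^1}_{i_1-2},\omega(e^{i_2}\wedge\dots\wedge e^{i_q}\wedge e^{i_q+1})\rangle.$$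
   Context: Cochains. $\Lambda^*(\mathfrak m_0)=\Lambda^*(e^1,e^2,\dots)$ is the exterior algebra on the dual elements $e^i$ ($e^i(e_j)=\delta_{ij}$), with the derivation differential of degree $+1$ given by $da(x,y)=a([x,y])$ on 1-forms, i.e. $de^1=de^2=0$, $de^i=e^1\wedge e^{i-1}$ for $i\ge3$. $H^*(\mathfrak m_0)$ is its cohomology (trivial coefficients). Cocycles $\omega(\cdot)$. Let $D_1$ be the (even) derivation of $\Lambda^*(e^2,e^3,\dots)$ with $D_1(e^2)=0$, $D_1(e^i)=e^{i-1}$ for $i\ge 3$, $D_1(\xi\wedge\eta)=D_1(\xi)\wedge\eta+\xi\wedge D_1(\eta)$. For $q\ge1$ and $2\le i_1<\dots<i_q$ put $$\omega(e^{i_1}\wedge\dots\wedge e^{i_q}\wedge e^{i_q+1})=\sum_{l\ge0}(-1)^lD_1^l(e^{i_1}\wedge\dots\wedge e^{i_q})\wedge e^{i_q+1+l},$$ a closed $(q+1)$-form. It is known (Fialowski–Millionschikov) that the classes of $e^1$, $e^2$ and of all these cocycles span $H^{*}(\mathfrak m_0)$ in positive degrees. Massey products. For a homogeneous $a\in\mathcal A^k$ of a graded-commutative differential graded algebra $\mathcal A$ put $\bar a=(-1)^{k+1}a$. Let $a_i\in\mathcal A^{p_i}$, $i=1,\dots,n$ ($n\ge 2$), be closed. A defining system for $\langle a_1,\dots,a_n\rangle$ is a collection $a(i,j)\in\mathcal A$, $1\le i\le j\le n$, $(i,j)\ne(1,n)$, with $a(i,i)=a_i$, $a(i,j)\in\mathcal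 A^{p(i,j)+1}$ where $p(i,j)=\sum_{r=i}^j(p_r-1)$, and $d\,a(i,j)=\sum_{r=i}^{j-1}\bar a(i,r)\,a(r+1,j)$ for $i<j$, $(i,j)\neq(1,n)$. Its related cocycle is $c=\sum_{r=1}^{n-1}\bar a(1,r)\,a(r+1,n)$. The Massey product $\langle a_1,\dots,a_n\rangle$ is defined if a defining system exists, and it is then the set of all cohomology classes $[c]$ of related cocycles; it depends only on the cohomology classes of the $a_i$. For $n=2$, $\langle a_1,a_2\rangle=\{[\bar a_1a_2]\}$. A defined Massey product is trivial if it contains $0$, and non-trivial otherwise. "Generated by $H^1$ with respect to non-trivial Massey products" means: the smallest linear subspace of $\bigoplus_{q\ge1}H^q(\mathfrak m_0)$ that contains $H^1(\mathfrak m_0)$ and contains every element of every defined non-trivial Massey product (with $n\ge2$) of homogeneous elements of it, is all of $\bigoplus_{q\ge1}H^q(\mathfrak m_0)$.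
   Formalization: In (2) the class 2[ω(e^k∧e^{k+1})] is replaced by (-1)^k·2[ω(e^k∧e^{k+1})]; with the stated conventions the original sign fails for every odd k (for k=3 the product gives -2ω(e^3∧e^4), never +2ω modulo exact forms). *)

theory Defs
  imports Complex_Main "HOL-Library.Poly_Mapping"
begin

section \<open>The exterior algebra on $e^1, e^2, \dots$\<close>

text \<open>
  The monomials \<open>e\<^sup>I = e\<^sup>i\<^sup>1 \<and> \<dots> \<and> e\<^sup>i\<^sup>p\<close>, with \<open>I = {i1 < \<dots> < ip}\<close> a finite set of positive integers,
  form a basis of the exterior algebra, so a form is a finitely supported coefficient function
  on such index sets.
\<close>

typedef ixset = "{I :: nat set. finite I \<and> 0 \<notin> I}"
  morphisms indices Ixset
  by (rule exI[of _ "{}"]) simp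

setup_lifting type_definition_ixset

type_synonym 'k form = "ixset \<Rightarrow>\<^sub>0 'k"

definition fscale :: "'k::field \<Rightarrow> ('i \<Rightarrow>\<^sub>0 'k) \<Rightarrow> ('i \<Rightarrow>\<^sub>0 'k)"  (infixr \<open>\<cdot>\<close> 75)
  where "c \<cdot> a = Poly_Mapping.map ((*) c) a"

text \<open>\<open>lin_ext g\<close> is the linear map with \<open>e\<^sup>I \<mapsto> g I\<close>.\<close>

definition lin_ext :: "(ixset \<Rightarrow> 'k::field form) \<Rightarrow> 'k form \<Rightarrow> 'k form"
  where "lin_ext g a = (\<Sum>I\<in>Poly_Mapping.keys a. Poly_Mapping.lookup a I \<cdot> g I)"

text \<open>\<open>e\<^sup>I \<and> e\<^sup>J\<close>: sorting the concatenation of \<open>I\<close> and \<open>J\<close> costs one sign per inversion.\<close>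

definition wedge_mon :: "ixset \<Rightarrow> ixset \<Rightarrow> 'k::field form"
  where "wedge_mon I J =
    (if indices I \<inter> indices J \<noteq> {} then 0
     else Poly_Mapping.single (Ixset (indices I \<union> indices J))
            ((- 1) ^ card {(i, j). i \<in> indices I \<and> j \<in> indices J \<and> j < i}))"

definition wedge :: "'k::field form \<Rightarrow> 'k form \<Rightarrow> 'k form"  (infixr \<open>\<^bold>\<and>\<close> 70)
  where "a \<^bold>\<and> b = lin_ext (\<lambda>I. lin_ext (\<lambda>J. wedge_mon I J) b) a"

definition one_form :: "'k::field form"
  where "one_form = Poly_Mapping.single (Ixset {}) 1"

text \<open>\<open>gen i\<close> is the generator \<open>e\<^sup>i\<close>, \<open>i \<ge> 1\<close>; there is no \<open>e\<^sup>0\<close>, and \<open>gen 0 = 0\<close>.\<close>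

definition gen :: "nat \<Rightarrow> 'k::field form"
  where "gen i = (if i = 0 then 0 else Poly_Mapping.single (Ixset {i}) 1)"

definition gens :: "nat list \<Rightarrow> 'k::field form"
  where "gens is = foldr (\<lambda>i a. gen i \<^bold>\<and> a) is one_form"

definition Lam :: "int \<Rightarrow> 'k::field form set"
  where "Lam k = {a. \<forall>I\<in>Poly_Mapping.keys a. int (card (indices I)) = k}"


section \<open>Derivations, the differential of $\Lambda^*(\mathfrak m_0)$, and $D_1$\<close>

text \<open>
  For \<open>s = -1\<close> (odd) or \<open>s = 1\<close> (even), \<open>derivation s f\<close> is the derivation with \<open>e\<^sup>i \<mapsto> f i\<close>,
  obtained by expanding the product rule along \<open>e\<^sup>i\<^sup>1 \<and> (e\<^sup>i\<^sup>2 \<and> \<dots>)\<close>.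
\<close>

primrec deriv_gens :: "'k::field \<Rightarrow> (nat \<Rightarrow> 'k form) \<Rightarrow> nat list \<Rightarrow> 'k form"
  where
    "deriv_gens s f [] = 0"
  | "deriv_gens s f (i # is) = f i \<^bold>\<and> gens is + s \<cdot> (gen i \<^bold>\<and> deriv_gens s f is)"

definition derivation :: "'k::field \<Rightarrow> (nat \<Rightarrow> 'k form) \<Rightarrow> 'k form \<Rightarrow> 'k form"
  where "derivation s f =
    lin_ext (\<lambda>I. deriv_gens s f (sorted_list_of_set (indices I)))"

text \<open>
  The bracket \<open>[e\<^sub>j, e\<^sub>k]\<close> of two basis elements of \<open>\<mm>\<^sub>0\<close>, as its coordinate vector in the
  basis \<open>e\<^sub>1, e\<^sub>2, \<dots>\<close>.
\<close>

definition m0_bracket :: "nat \<Rightarrow> nat \<Rightarrow> (nat \<Rightarrow>\<^sub>0 'k::field)"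
  where "m0_bracket j k =
    (if j = 1 \<and> 2 \<le> k then Poly_Mapping.single (k + 1) 1
     else if k = 1 \<and> 2 \<le> j then - Poly_Mapping.single (j + 1) 1
     else 0)"

text \<open>
  The two-form \<open>d e\<^sup>i\<close> has the value \<open>e\<^sup>i([e\<^sub>j, e\<^sub>k])\<close> on \<open>(e\<^sub>j, e\<^sub>k)\<close>, which is its coefficient at
  \<open>e\<^sup>j \<and> e\<^sup>k\<close> for \<open>j < k\<close>.  The closed formulas are \<open>diff_gen_1\<close>, \<open>diff_gen_2\<close>, \<open>diff_gen\<close> below.
\<close>

definition diff_on_gen :: "nat \<Rightarrow> 'k::field form"
  where "diff_on_gen i =
    (\<Sum>(j, k) | j < k \<and> Poly_Mapping.lookup (m0_bracket j k :: nat \<Rightarrow>\<^sub>0 'k) i \<noteq> 0.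
       Poly_Mapping.lookup (m0_bracket j k) i \<cdot> (gen j \<^bold>\<and> gen k))"

definition diff :: "'k::field form \<Rightarrow> 'k form"
  where "diff = derivation (- 1) diff_on_gen"

text \<open>
  \<open>D\<^sub>1\<close> is only ever used on \<open>\<Lambda>\<^sup>*(e\<^sup>2, e\<^sup>3, \<dots>)\<close>; putting \<open>D\<^sub>1 e\<^sup>1 = 0\<close> makes it total.
\<close>

definition D1 :: "'k::field form \<Rightarrow> 'k form"
  where "D1 = derivation 1 (\<lambda>i. if 3 \<le> i then gen (i - 1) else 0)"

text \<open>
  \<open>omega [i1, \<dots>, iq]\<close> is \<open>\<omega>(e\<^sup>i\<^sup>1 \<and> \<dots> \<and> e\<^sup>i\<^sup>q \<and> e\<^sup>i\<^sup>q\<^sup>+\<^sup>1)\<close>, where the index of the last factor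
  is \<open>iq + 1\<close>.  The sum over \<open>l \<ge> 0\<close> runs over its finitely many non-zero powers
  \<open>D\<^sub>1\<^sup>l(e\<^sup>i\<^sup>1 \<and> \<dots> \<and> e\<^sup>i\<^sup>q)\<close>.
\<close>

definition omega :: "nat list \<Rightarrow> 'k::field form"
  where "omega is =
    (\<Sum>l | (D1 ^^ l) (gens is :: 'k form) \<noteq> 0.
       (- 1) ^ l \<cdot> ((D1 ^^ l) (gens is) \<^bold>\<and> gen (last is + 1 + l)))"


section \<open>Linearity\<close>

lemma lookup_fscale [simp]:
  "Poly_Mapping.lookup (c \<cdot> a) i = c * Poly_Mapping.lookup a i"
  by (simp add: fscale_def Poly_Mapping.map.rep_eq when_def)

lemma vector_space_fscale: "vector_space (fscale :: 'k::field \<Rightarrow> ('i \<Rightarrow>\<^sub>0 'k) \<Rightarrow> _)"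
  by unfold_locales (auto intro!: poly_mapping_eqI simp: lookup_add algebra_simps)

interpretation form: vector_space "fscale :: 'k::field \<Rightarrow> ('i \<Rightarrow>\<^sub>0 'k) \<Rightarrow> _"
  by (rule vector_space_fscale)

lemma lin_ext_superset:
  assumes "finite A" "Poly_Mapping.keys a \<subseteq> A"
  shows "lin_ext g a = (\<Sum>I\<in>A. Poly_Mapping.lookup a I \<cdot> g I)"
  unfolding lin_ext_def
  by (rule sum.mono_neutral_left) (use assms in \<open>auto simp: in_keys_iff\<close>)

lemma lin_ext_add: "lin_ext g (a + b) = lin_ext g a + lin_ext g b"
proof -
  let ?A = "Poly_Mapping.keys a \<union> Poly_Mapping.keys b"
  have "Poly_Mapping.keys (a + b) \<subseteq> ?A" by (rule Poly_Mapping.keys_add)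
  then show ?thesis
    by (subst (1 2 3) lin_ext_superset[of ?A])
      (auto simp: lookup_add form.scale_left_distrib sum.distrib)
qed

lemma lin_ext_scale: "lin_ext g (c \<cdot> a) = c \<cdot> lin_ext g a"
proof -
  have "Poly_Mapping.keys (c \<cdot> a) \<subseteq> Poly_Mapping.keys a"
    by (auto simp: in_keys_iff)
  then show ?thesis
    by (subst (1 2) lin_ext_superset[of "Poly_Mapping.keys a"])
      (auto simp: form.scale_sum_right)
qed

lemma linear_lin_ext: "Vector_Spaces.linear fscale fscale (lin_ext g)"
  by unfold_locales (simp_all add: lin_ext_add lin_ext_scale)

lemma linear_diff: "Vector_Spaces.linear fscale fscale diff"
  by (simp add: diff_def derivation_def linear_lin_ext)

interpretation diff: Vector_Spaces.linear fscale fscale "diff :: 'k::field form \<Rightarrow> 'k form"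
  by (rule linear_diff)

lemma lin_ext_single [simp]: "lin_ext g (Poly_Mapping.single I c) = c \<cdot> g I"
  by (cases "c = 0") (simp_all add: lin_ext_def)

lemma lin_ext_zero [simp]: "lin_ext g 0 = 0"
  by (simp add: lin_ext_def)

lemma indices_Ixset [simp]: "finite I \<Longrightarrow> 0 \<notin> I \<Longrightarrow> indices (Ixset I) = I"
  by (simp add: Ixset_inverse)

lemma Ixset_eq_iff:
  "finite I \<Longrightarrow> 0 \<notin> I \<Longrightarrow> finite J \<Longrightarrow> 0 \<notin> J \<Longrightarrow> Ixset I = Ixset J \<longleftrightarrow> I = J"
  by (simp add: Ixset_inject)

lemma wedge_zero_left [simp]: "0 \<^bold>\<and> a = 0"
  by (simp add: wedge_def)

lemma wedge_zero_right [simp]: "a \<^bold>\<and> 0 = 0"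
  by (simp add: wedge_def lin_ext_def)

lemma lin_ext_id: "lin_ext (\<lambda>I. Poly_Mapping.single I 1) a = a"
proof (rule poly_mapping_eqI)
  fix J
  have "Poly_Mapping.lookup (lin_ext (\<lambda>I. Poly_Mapping.single I 1) a) J =
      (\<Sum>I\<in>Poly_Mapping.keys a. if I = J then Poly_Mapping.lookup a I else 0)"
    unfolding lin_ext_def lookup_sum
    by (rule sum.cong) (auto simp: lookup_single when_def)
  also have "\<dots> = Poly_Mapping.lookup a J"
    by (simp add: in_keys_iff)
  finally show "Poly_Mapping.lookup (lin_ext (\<lambda>I. Poly_Mapping.single I 1) a) J =
      Poly_Mapping.lookup a J" .
qed

lemma wedge_one_left [simp]: "one_form \<^bold>\<and> a = a"
  by (simp add: wedge_def one_form_def wedge_mon_def indices_inverse lin_ext_id)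

lemma wedge_one_right [simp]: "a \<^bold>\<and> one_form = a"
  by (simp add: wedge_def one_form_def wedge_mon_def indices_inverse lin_ext_id)

lemma derivation_gen:
  "i \<ge> 1 \<Longrightarrow> derivation s f (gen i) = f i"
  by (simp add: derivation_def gen_def gens_def)

lemma lookup_m0_bracket:
  "Poly_Mapping.lookup (m0_bracket j k :: nat \<Rightarrow>\<^sub>0 'k::field) i =
    (if j = 1 \<and> 2 \<le> k \<and> i = k + 1 then 1
     else if k = 1 \<and> 2 \<le> j \<and> i = j + 1 then - 1 else 0)"
  by (simp add: m0_bracket_def lookup_single when_def)

lemma m0_bracket_support:
  "{(j, k). j < k \<and> Poly_Mapping.lookup (m0_bracket j k :: nat \<Rightarrow>\<^sub>0 'k::field) i \<noteq> 0} =
    (if 3 \<le> i then {(1, i - 1)} else {})"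
  unfolding lookup_m0_bracket by auto

lemma diff_on_gen_eq:
  "diff_on_gen i = (if 3 \<le> i then gen 1 \<^bold>\<and> gen (i - 1) else 0)"
  unfolding diff_on_gen_def m0_bracket_support by (auto simp: lookup_m0_bracket)

lemma diff_gen_1: "diff (gen 1) = 0"
  and diff_gen_2: "diff (gen 2) = 0"
  and diff_gen: "3 \<le> i \<Longrightarrow> diff (gen i) = gen 1 \<^bold>\<and> gen (i - 1)"
  by (simp_all add: diff_def derivation_gen diff_on_gen_eq)


section \<open>Cohomology\<close>

text \<open>
  \<open>H\<^sup>*(\<mm>\<^sub>0)\<close> as the quotient of the cocycles by the coboundaries.  The class \<open>cls a\<close> is meaningful
  for closed \<open>a\<close> only.
\<close>

definition cohomologous :: "'k::field form \<Rightarrow> 'k form \<Rightarrow> bool"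
  where "cohomologous a b \<longleftrightarrow> diff a = 0 \<and> diff b = 0 \<and> (\<exists>x. a - b = diff x)"

quotient_type (overloaded) 'k coho = "'k::field form" / partial: cohomologous
  morphisms coho_rep cls
proof (rule part_equivpI)
  show "\<exists>a. cohomologous a a"
    by (auto simp: cohomologous_def intro!: exI[of _ 0] simp: diff.zero)
  show "symp cohomologous"
    by (rule sympI) (auto simp: cohomologous_def, metis diff.neg minus_diff_eq)
  show "transp cohomologous"
    by (rule transpI) (auto simp: cohomologous_def, metis diff.add diff_add_cancel add_diff_eq)
qed

instantiation coho :: (field) ab_group_add
begin

lift_definition zero_coho :: "'a coho" is 0
  by (auto simp: cohomologous_def diff.zero intro: exI[of _ 0])

lift_definition plus_coho :: "'a coho \<Rightarrow> 'a coho \<Rightarrow> 'a coho" is "(+)"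
  by (auto simp: cohomologous_def diff.add, metis diff.add add_diff_add)

lift_definition uminus_coho :: "'a coho \<Rightarrow> 'a coho" is uminus
  by (auto simp: cohomologous_def diff.neg, metis diff.neg minus_diff_eq minus_diff_minus)

definition minus_coho :: "'a coho \<Rightarrow> 'a coho \<Rightarrow> 'a coho"
  where "minus_coho a b = a + - b"

instance
  by standard
    (unfold minus_coho_def, (transfer, auto simp: cohomologous_def diff.add diff.neg diff.zero
      algebra_simps intro: exI[of _ 0])+)

end

lift_definition coho_scale :: "'k::field \<Rightarrow> 'k coho \<Rightarrow> 'k coho"  (infixr \<open>\<cdot>\<^sub>H\<close> 75) is fscale
  by (auto simp: cohomologous_def diff.scale, metis diff.scale form.scale_right_diff_distrib)

interpretation coho: vector_space "coho_scale :: 'k::field \<Rightarrow> 'k coho \<Rightarrow> 'k coho"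
  by standard
    (transfer, auto simp: cohomologous_def diff.add diff.scale diff.zero form.scale_right_distrib
      form.scale_left_distrib intro: exI[of _ 0])+

definition H :: "int \<Rightarrow> 'k::field coho set"
  where "H q = {cls a | a. a \<in> Lam q \<and> diff a = 0}"

text \<open>The internal sum \<open>\<Oplus>\<^sub>q\<^sub>\<ge>\<^sub>1 H\<^sup>q\<close>.\<close>

definition H_pos :: "'k::field coho set"
  where "H_pos = coho.span (\<Union>q\<in>{1..}. H q)"


section \<open>Massey products\<close>

text \<open>
  A Massey product \<open>\<langle>a\<^sub>1, \<dots>, a\<^sub>n\<rangle>\<close> is given by the list \<open>ps = [p\<^sub>1, \<dots>, p\<^sub>n]\<close> of degrees and the
  list \<open>as = [a\<^sub>1, \<dots>, a\<^sub>n]\<close> of closed forms \<open>a\<^sub>i \<in> \<Lambda>\<^sup>p\<^sup>i\<close>; the degrees are kept as data because the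
  zero form is homogeneous of every degree.
\<close>

definition bar :: "int \<Rightarrow> 'k::field form \<Rightarrow> 'k form"
  where "bar k a = (if even (k + 1) then a else - a)"

text \<open>The degree \<open>p(i, j) + 1\<close> of \<open>a(i, j)\<close>; list positions start at 0, indices \<open>i, j\<close> at 1.\<close>

definition massey_deg :: "int list \<Rightarrow> nat \<Rightarrow> nat \<Rightarrow> int"
  where "massey_deg ps i j = (\<Sum>r=i..j. ps ! (r - 1) - 1) + 1"

definition massey_arguments :: "int list \<Rightarrow> 'k::field form list \<Rightarrow> bool"
  where "massey_arguments ps as \<longleftrightarrow>
    length ps = length as \<and> 2 \<le> length as \<and>
    (\<forall>i<length as. as ! i \<in> Lam (ps ! i) \<and> diff (as ! i) = 0)"

definition massey_sum :: "int list \<Rightarrow> (nat \<Rightarrow> nat \<Rightarrow> 'k::field form) \<Rightarrow> nat \<Rightarrow> nat \<Rightarrow> 'k form"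
  where "massey_sum ps A i j =
    (\<Sum>r=i..<j. bar (massey_deg ps i r) (A i r) \<^bold>\<and> A (r + 1) j)"

definition defining_system ::
    "int list \<Rightarrow> 'k::field form list \<Rightarrow> (nat \<Rightarrow> nat \<Rightarrow> 'k form) \<Rightarrow> bool"
  where "defining_system ps as A \<longleftrightarrow>
    massey_arguments ps as \<and>
    (\<forall>i j. 1 \<le> i \<and> i \<le> j \<and> j \<le> length as \<and> (i, j) \<noteq> (1, length as) \<longrightarrow>
       A i j \<in> Lam (massey_deg ps i j) \<and>
       (i = j \<longrightarrow> A i j = as ! (i - 1)) \<and>
       (i < j \<longrightarrow> diff (A i j) = massey_sum ps A i j))"

definition massey :: "int list \<Rightarrow> 'k::field form list \<Rightarrow> 'k coho set"
  where "massey ps as = {cls (massey_sum ps A 1 (length as)) | A. defining_system ps as A}"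

definition massey_defined :: "int list \<Rightarrow> 'k::field form list \<Rightarrow> bool"
  where "massey_defined ps as \<longleftrightarrow> (\<exists>A. defining_system ps as A)"

definition massey_nontrivial :: "int list \<Rightarrow> 'k::field form list \<Rightarrow> bool"
  where "massey_nontrivial ps as \<longleftrightarrow> massey_defined ps as \<and> 0 \<notin> massey ps as"

text \<open>
  Massey products of classes in \<open>S\<close> are computed from arbitrary closed representatives.
\<close>

definition massey_closed :: "'k::field coho set \<Rightarrow> bool"
  where "massey_closed S \<longleftrightarrow>
    (\<forall>ps as. (\<forall>p\<in>set ps. 1 \<le> p) \<and> massey_nontrivial ps as \<and> cls ` set as \<subseteq> S \<longrightarrow>
       massey ps as \<subseteq> S)"

definition massey_generated :: "'k::field coho set \<Rightarrow> 'k coho set"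
  where "massey_generated X =
    \<Inter> {S. coho.subspace S \<and> S \<subseteq> H_pos \<and> X \<subseteq> S \<and> massey_closed S}"

end

(*
  The differential is left multiplication by e^1 composed with D_1, and every form splits as
  a_0 + e^1 a_1 with a_0, a_1 free of e^1.  Hence a form is closed iff D_1 a_0 = 0, and exact
  forms have no coefficient at a monomial free of e^1.

  For n >= 3 the alternating sum
     omega_ext xi n = xi e^n - (D_1 xi) e^(n+1) + (D_1^2 xi) e^(n+2) - ...
  satisfies D_1 (omega_ext xi n) = xi e^(n-1).  So xi e^i |-> omega_ext xi (i + 1), for i above
  all indices of xi, is a right inverse Q of D_1 in positive degrees.  The kernel of D_1 is the image of
  1 - Q D_1, and 1 - Q D_1 sends a monomial xi e^i of degree at least 2 to 0 or to a cocycle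
  omega; this gives the spanning set of the cohomology.

  For <e^2, e^1, ..., e^1, c>, put a(1,j) = (-1)^(j-1) e^(j+1) and take successive
  D_1-antiderivatives of c for the entries of the last column; the related cocycle is the
  claimed one.  Conversely, the coefficients at e^1 e^s of the defining equations show, for an
  arbitrary defining system, that a(1,j) involves no e^s with s > j + 1 and has coefficient
  (-1)^(j-1) at e^(j+1).  Hence a suitable coefficient of the related cocycle, at a monomial
  free of e^1, is the same nonzero number for all defining systems, and the cocycle is not
  exact.
*)
theory Submission
  imports Defs
begin

section \<open>The exterior product\<close>

text \<open>The antiderivatives of omega(xi) carry binomial weights, and these come from the Leibniz
  rule: of the t + u derivatives in D_1^(t+u) (e^i xi), t fall on e^i in (t+u choose t) ways.
  Grouping omega(e^i xi) by t therefore gives, up to signs, e^(i-t) times the t-th antiderivative of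
  omega(xi), and these are the summands of the related cocycle. The two agree as forms, without a
  correction by a coboundary. If c = e^2, the antiderivatives are e^3, e^4, ..., and the cocycle is
  an alternating sum of e^a e^b with a + b = m + 4, where m counts the factors e^1. Swapping a and b
  pairs the summands. For even m the pairs cancel; for odd m = 2k - 3 they agree. Hence the factor
  2, which must be invertible both for non-triviality and for generation. Only non-trivial products
  may be used for generating, so non-triviality is needed there as well. A defining system is far
  from unique, but the free choices affect only low coefficients: the equations are triangular in
  the index s, and the top coefficient of each entry that matters is forced.\<close>

declare One_nat_def [simp del]

abbreviation mon :: "ixset \<Rightarrow> 'k::field form"
  where "mon I \<equiv> Poly_Mapping.single I 1"

lemma finite_indices [simp]: "finite (indices I)"
  and zero_notin_indices [simp]: "0 \<notin> indices I"
  using indices[of I] by auto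

lemma form_in_span_mon: "a \<in> form.span (mon ` Poly_Mapping.keys a)"
proof -
  have "lin_ext mon a \<in> form.span (mon ` Poly_Mapping.keys a)"
    unfolding lin_ext_def by (intro form.span_sum form.span_scale form.span_base) auto
  then show ?thesis by (simp add: lin_ext_id)
qed

lemma form_induct [case_names mon zero add scale]:
  assumes "\<And>I. I \<in> Poly_Mapping.keys a \<Longrightarrow> P (mon I)" "P 0"
    and "\<And>a b. P a \<Longrightarrow> P b \<Longrightarrow> P (a + b)" "\<And>c a. P a \<Longrightarrow> P (c \<cdot> a)"
  shows "P a"
  using form_in_span_mon[of a]
  by (rule form.span_induct) (auto intro: assms simp: form.subspace_def)

lemma lin_ext_fun_add: "lin_ext (\<lambda>I. g I + h I) a = lin_ext g a + lin_ext h a"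
  by (simp add: lin_ext_def form.scale_right_distrib sum.distrib)

lemma lin_ext_fun_scale: "lin_ext (\<lambda>I. c \<cdot> g I) a = c \<cdot> lin_ext g a"
  by (simp add: lin_ext_def form.scale_sum_right mult.commute)

lemma wedge_add_left: "(a + b) \<^bold>\<and> c = a \<^bold>\<and> c + b \<^bold>\<and> c"
  by (simp add: wedge_def lin_ext_add)

lemma wedge_add_right: "a \<^bold>\<and> (b + c) = a \<^bold>\<and> b + a \<^bold>\<and> c"
  by (simp add: wedge_def lin_ext_add lin_ext_fun_add)

lemma wedge_scale_left [simp]: "(r \<cdot> a) \<^bold>\<and> c = r \<cdot> (a \<^bold>\<and> c)"
  by (simp add: wedge_def lin_ext_scale)

lemma wedge_scale_right [simp]: "a \<^bold>\<and> (r \<cdot> b) = r \<cdot> (a \<^bold>\<and> b)"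
  by (simp add: wedge_def lin_ext_scale lin_ext_fun_scale)

lemma wedge_minus_left [simp]: "(- a) \<^bold>\<and> b = - (a \<^bold>\<and> b)"
  using wedge_scale_left[of "- 1" a b] by simp

lemma wedge_minus_right [simp]: "a \<^bold>\<and> (- b) = - (a \<^bold>\<and> b)"
  using wedge_scale_right[of a "- 1" b] by simp

lemma wedge_sum_left: "(\<Sum>i\<in>A. f i) \<^bold>\<and> b = (\<Sum>i\<in>A. f i \<^bold>\<and> b)"
  by (induction A rule: infinite_finite_induct) (auto simp: wedge_add_left)

lemma wedge_sum_right: "b \<^bold>\<and> (\<Sum>i\<in>A. f i) = (\<Sum>i\<in>A. b \<^bold>\<and> f i)"
  by (induction A rule: infinite_finite_induct) (auto simp: wedge_add_right)

definition inversions :: "nat set \<Rightarrow> nat set \<Rightarrow> nat"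
  where "inversions I J = card {(i, j). i \<in> I \<and> j \<in> J \<and> j < i}"

lemma finite_inversions: "finite I \<Longrightarrow> finite J \<Longrightarrow> finite {(i, j). i \<in> I \<and> j \<in> J \<and> j < i}"
  by (rule finite_subset[of _ "I \<times> J"]) auto

lemma inversions_Un_left:
  assumes "finite I" "finite J" "finite K" "I \<inter> J = {}"
  shows "inversions (I \<union> J) K = inversions I K + inversions J K"
proof -
  have "{(i, j). i \<in> I \<union> J \<and> j \<in> K \<and> j < i} =
      {(i, j). i \<in> I \<and> j \<in> K \<and> j < i} \<union> {(i, j). i \<in> J \<and> j \<in> K \<and> j < i}"
    by auto
  then show ?thesis
    unfolding inversions_def
    by (simp only:) (rule card_Un_disjoint, use assms in \<open>auto intro: finite_inversions\<close>)
qed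

lemma inversions_Un_right:
  assumes "finite I" "finite J" "finite K" "J \<inter> K = {}"
  shows "inversions I (J \<union> K) = inversions I J + inversions I K"
proof -
  have "{(i, j). i \<in> I \<and> j \<in> J \<union> K \<and> j < i} =
      {(i, j). i \<in> I \<and> j \<in> J \<and> j < i} \<union> {(i, j). i \<in> I \<and> j \<in> K \<and> j < i}"
    by auto
  then show ?thesis
    unfolding inversions_def
    by (simp only:) (rule card_Un_disjoint, use assms in \<open>auto intro: finite_inversions\<close>)
qed

lemma mon_wedge_mon:
  "mon I \<^bold>\<and> mon J = (if indices I \<inter> indices J \<noteq> {} then 0
     else (- 1) ^ inversions (indices I) (indices J) \<cdot> mon (Ixset (indices I \<union> indices J)))"
  by (auto simp: wedge_def wedge_mon_def inversions_def intro!: poly_mapping_eqI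
      simp: lookup_single when_def)

text \<open>On monomials with pairwise disjoint index sets both sides carry the sign exponent
  inv(I,J) + inv(I,K) + inv(J,K), because \<open>inversions\<close> is additive in either argument.
  If two of the sets meet, both sides vanish.\<close>

lemma wedge_assoc: "(a \<^bold>\<and> b) \<^bold>\<and> c = a \<^bold>\<and> (b \<^bold>\<and> c)"
proof (induction a rule: form_induct)
  case (mon I)
  show ?case
  proof (induction b rule: form_induct)
    case (mon J)
    show ?case
    proof (induction c rule: form_induct)
      case (mon K)
      show ?case
      proof (cases "indices I \<inter> indices J = {} \<and> indices I \<inter> indices K = {} \<and> indices J \<inter> indices K = {}")
        case True
        then show ?thesis
          by (simp add: mon_wedge_mon inversions_Un_left inversions_Un_right Un_assoc Int_Un_distrib
              Int_Un_distrib2 flip: power_add) (simp add: ac_simps)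
      next
        case False
        then show ?thesis by (auto simp: mon_wedge_mon)
      qed
    qed (simp_all add: wedge_add_right)
  qed (simp_all add: wedge_add_left wedge_add_right)
qed (simp_all add: wedge_add_left)

section \<open>Products with a single generator and their coefficients\<close>

lemma gen_eq_mon: "i \<ge> 1 \<Longrightarrow> gen i = mon (Ixset {i})"
  by (simp add: gen_def)

lemma inversions_single_left: "inversions {i} J = card {j \<in> J. j < i}"
proof -
  have "{(i', j). i' \<in> {i} \<and> j \<in> J \<and> j < i'} = Pair i ` {j \<in> J. j < i}" by auto
  then show ?thesis unfolding inversions_def by (simp add: card_image inj_on_def)
qed

lemma gen_wedge_mon:
  assumes "i \<ge> 1"
  shows "gen i \<^bold>\<and> mon J = (if i \<in> indices J then 0
     else (- 1) ^ card {j \<in> indices J. j < i} \<cdot> mon (Ixset (insert i (indices J))))"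
  using assms by (auto simp: gen_eq_mon mon_wedge_mon inversions_single_left)

lemma eq_Ixset_iff: "finite J \<Longrightarrow> 0 \<notin> J \<Longrightarrow> I = Ixset J \<longleftrightarrow> indices I = J"
  by (auto simp: indices_inverse)

text \<open>The only monomial that e^i can turn into a multiple of e^I is e^(I - {i}); moving e^i
  into place passes the indices of I below i.\<close>

lemma lookup_gen_wedge:
  assumes "i \<ge> 1"
  shows "Poly_Mapping.lookup (gen i \<^bold>\<and> b) I = (if i \<in> indices I then
     (- 1) ^ card {j \<in> indices I. j < i} * Poly_Mapping.lookup b (Ixset (indices I - {i})) else 0)"
proof (induction b rule: form_induct)
  case (mon J)
  have [simp]: "0 \<notin> insert i (indices J)" "0 \<notin> indices I - {i}" using assms by auto
  have lookup: "Poly_Mapping.lookup (Poly_Mapping.single K (1::'a)) L = (if K = L then 1 else 0)" for K L :: ixset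
    by (simp add: lookup_single when_def)
  have I: "Ixset (insert i (indices J)) = I \<longleftrightarrow> indices I = insert i (indices J)"
    by (subst eq_commute, rule eq_Ixset_iff) (use assms in auto)
  have J: "J = Ixset (indices I - {i}) \<longleftrightarrow> indices J = indices I - {i}"
    by (rule eq_Ixset_iff) auto
  consider "i \<in> indices J" | "i \<notin> indices J" "indices I = insert i (indices J)"
    | "i \<notin> indices J" "indices I \<noteq> insert i (indices J)" "i \<in> indices I \<Longrightarrow> indices J \<noteq> indices I - {i}"
    by blast
  then show ?case
  proof cases
    case 1
    then show ?thesis using assms J by (auto simp: gen_wedge_mon lookup)
  next
    case 2
    then have 3: "{j \<in> indices J. j < i} = {j \<in> indices I. j < i}" by auto
    have "i \<in> indices I" using 2 by simp
    moreover have "Poly_Mapping.lookup (mon (Ixset (insert i (indices J)))) I = (1::'a)"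
      using 2(2) by (simp only: lookup I refl if_True)
    moreover have "J = Ixset (indices I - {i})" unfolding J using 2 by blast
    then have "Poly_Mapping.lookup (mon J) (Ixset (indices I - {i})) = (1::'a)"
      by (metis lookup_single_eq)
    ultimately show ?thesis using assms 2(1) 3
      by (simp add: gen_wedge_mon)
  next
    case 3
    then show ?thesis using assms I J by (simp add: gen_wedge_mon lookup)
  qed
qed (auto simp: wedge_add_right lookup_add distrib_left mult.left_commute)

lemma gen_wedge_self [simp]: "gen i \<^bold>\<and> gen i = 0"
  by (simp add: gen_def mon_wedge_mon)

lemma gen_wedge_anticomm: "gen i \<^bold>\<and> gen j = - (gen j \<^bold>\<and> gen i)"
proof -
  have *: "gen i \<^bold>\<and> gen j = - (gen j \<^bold>\<and> gen i :: 'a form)" if "1 \<le> i" "i < j" for i j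
  proof -
    have ij: "i \<ge> 1" "j \<ge> 1" "i \<noteq> j" using that by auto
    have [simp]: "{i'. i' = j \<and> i' < i} = {}" "{i'. i' = i \<and> i' < j} = {i}" using that by auto
    show ?thesis
      using ij by (simp add: gen_eq_mon mon_wedge_mon inversions_single_left insert_commute)
  qed
  show ?thesis
  proof (cases "i = 0 \<or> j = 0 \<or> i = j")
    case True
    then show ?thesis by (auto simp: gen_wedge_self) (simp_all add: gen_def)
  next
    case False
    then show ?thesis using *[of i j] *[of j i] by (cases "i < j") auto
  qed
qed

lemma gen_wedge_gen_wedge_anticomm: "gen i \<^bold>\<and> gen j \<^bold>\<and> a = - (gen j \<^bold>\<and> gen i \<^bold>\<and> a)"
  unfolding wedge_assoc[symmetric] by (subst gen_wedge_anticomm) simp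

lemma gens_Nil [simp]: "gens [] = one_form"
  and gens_Cons [simp]: "gens (i # is) = gen i \<^bold>\<and> gens is"
  by (simp_all add: gens_def)

lemma gens_append: "gens (is @ js) = gens is \<^bold>\<and> gens js"
  by (induction "is") (auto simp: wedge_assoc)

lemma gens_sorted:
  "sorted_wrt (<) is \<Longrightarrow> 0 \<notin> set is \<Longrightarrow> gens is = mon (Ixset (set is))"
proof (induction "is")
  case (Cons i "is")
  have [simp]: "{j \<in> set is. j < i} = {}" using Cons.prems by auto
  show ?case using Cons by (auto simp: gen_wedge_mon)
qed (simp add: one_form_def)

lemma mon_eq_gens: "mon I = gens (sorted_list_of_set (indices I))"
  by (simp add: gens_sorted indices_inverse)

lemma form_induct_gens [case_names gens zero add scale]:
  assumes "\<And>I. I \<in> Poly_Mapping.keys a \<Longrightarrow> P (gens (sorted_list_of_set (indices I)))" "P 0"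
    and "\<And>a b. P a \<Longrightarrow> P b \<Longrightarrow> P (a + b)" "\<And>c a. P a \<Longrightarrow> P (c \<cdot> a)"
  shows "P a"
  by (rule form_induct[of a P]) (use assms in \<open>simp_all flip: mon_eq_gens\<close>)

section \<open>Derivations\<close>

text \<open>One notion for all coordinate subspaces: restrictions on degree, on the range of
  indices, and combinations of both are instances, so they share their closure properties and one
  induction rule.\<close>

definition forms_with :: "(ixset \<Rightarrow> bool) \<Rightarrow> 'k::field form set"
  where "forms_with X = {a. \<forall>I\<in>Poly_Mapping.keys a. X I}"

abbreviation forms_on :: "nat set \<Rightarrow> 'k::field form set"
  where "forms_on S \<equiv> forms_with (\<lambda>I. indices I \<subseteq> S)"

lemma Lam_eq: "Lam k = forms_with (\<lambda>I. int (card (indices I)) = k)"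
  by (simp add: Lam_def forms_with_def)

lemma subspace_forms_with: "form.subspace (forms_with X)"
  unfolding form.subspace_def
proof (intro conjI ballI allI)
  fix a b :: "'a form" assume "a \<in> forms_with X" "b \<in> forms_with X"
  then show "a + b \<in> forms_with X"
    using Poly_Mapping.keys_add[of a b] unfolding forms_with_def by blast
qed (auto simp: forms_with_def in_keys_iff)

lemmas forms_with_zero [simp] = form.subspace_0[OF subspace_forms_with]
  and forms_with_add = form.subspace_add[OF subspace_forms_with]
  and forms_with_scale = form.subspace_scale[OF subspace_forms_with]
  and forms_with_sum = form.subspace_sum[OF subspace_forms_with]
  and forms_with_diff = form.subspace_diff[OF subspace_forms_with]
  and forms_with_neg = form.subspace_neg[OF subspace_forms_with]

lemma mon_in_forms_with [simp]: "mon I \<in> forms_with X \<longleftrightarrow> X I"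
  by (simp add: forms_with_def)

lemma forms_with_induct [consumes 1, case_names gens zero add scale]:
  assumes "a \<in> forms_with X"
    and "\<And>I. X I \<Longrightarrow> P (gens (sorted_list_of_set (indices I)))" "P 0"
    and "\<And>a b. P a \<Longrightarrow> P b \<Longrightarrow> P (a + b)" "\<And>c a. P a \<Longrightarrow> P (c \<cdot> a)"
  shows "P a"
  by (rule form_induct[of a P]) (use assms in \<open>auto simp: mon_eq_gens forms_with_def\<close>)

lemma forms_with_wedge:
  assumes "a \<in> forms_with X" "b \<in> forms_with Y"
    and "\<And>I J. X I \<Longrightarrow> Y J \<Longrightarrow> indices I \<inter> indices J = {} \<Longrightarrow> Z (Ixset (indices I \<union> indices J))"
  shows "a \<^bold>\<and> b \<in> forms_with Z"
  using assms(1)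
proof (induction a rule: forms_with_induct)
  case (gens I)
  show ?case using assms(2)
  proof (induction b rule: forms_with_induct)
    case (gens J)
    then show ?case using assms(3)[OF \<open>X I\<close> \<open>Y J\<close>]
      by (auto simp: mon_wedge_mon forms_with_scale simp flip: mon_eq_gens)
  qed (simp_all add: wedge_add_right forms_with_add forms_with_scale)
qed (simp_all add: wedge_add_left forms_with_add forms_with_scale)

lemma forms_on_wedge: "a \<in> forms_on S \<Longrightarrow> b \<in> forms_on S \<Longrightarrow> a \<^bold>\<and> b \<in> forms_on S"
  by (erule forms_with_wedge, assumption) auto

lemma Lam_wedge: "a \<in> Lam k \<Longrightarrow> b \<in> Lam l \<Longrightarrow> a \<^bold>\<and> b \<in> Lam (k + l)"
  unfolding Lam_eq by (erule forms_with_wedge, assumption) (auto simp: card_Un_disjoint)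

lemma forms_on_gen: "i \<in> S \<Longrightarrow> gen i \<in> forms_on S"
  by (cases "i = 0") (simp_all add: gen_def)

lemma one_form_eq_mon: "one_form = mon (Ixset {})"
  by (simp add: one_form_def)

lemma forms_on_gens: "set is \<subseteq> S \<Longrightarrow> gens is \<in> forms_on S"
  by (induction "is") (simp_all add: one_form_eq_mon forms_on_wedge forms_on_gen)

lemma Lam_gen: "gen i \<in> Lam 1"
  by (cases "i = 0") (simp_all add: gen_def Lam_eq)

lemma Lam_gens: "gens is \<in> Lam (int (length is))"
proof (induction "is")
  case (Cons i "is")
  then show ?case using Lam_wedge[OF Lam_gen Cons.IH] by (simp add: add.commute)
qed (simp add: one_form_eq_mon Lam_eq)

section \<open>The product rule for derivations given on generators\<close>

lemma derivation_add: "derivation s f (a + b) = derivation s f a + derivation s f b"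
  and derivation_scale: "derivation s f (c \<cdot> a) = c \<cdot> derivation s f a"
  and derivation_zero [simp]: "derivation s f 0 = 0"
  by (simp_all add: derivation_def lin_ext_add lin_ext_scale)

lemma derivation_minus: "derivation s f (- a) = - derivation s f a"
  using derivation_scale[of s f "- 1" a] by simp

lemma derivation_gens_sorted:
  assumes "sorted_wrt (<) is" "0 \<notin> set is"
  shows "derivation s f (gens is) = deriv_gens s f is"
proof -
  have "sorted_list_of_set (set is) = is"
    using assms by (simp add: sorted_list_of_set.idem_if_sorted_distinct strict_sorted_iff)
  then show ?thesis using assms by (simp add: gens_sorted derivation_def)
qed

text \<open>\<open>deriv_gens\<close> expands along the smallest index, so the product rule is
  immediate when e^i precedes every index of a.\<close>

lemma derivation_gen_wedge_above:
  assumes "i \<ge> 1" "a \<in> forms_on {i<..}"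
  shows "derivation s f (gen i \<^bold>\<and> a) = f i \<^bold>\<and> a + s \<cdot> (gen i \<^bold>\<and> derivation s f a)"
  using assms(2)
proof (induction a rule: forms_with_induct)
  case (gens J)
  let ?js = "sorted_list_of_set (indices J)"
  have js: "sorted_wrt (<) (i # ?js)" "0 \<notin> set (i # ?js)"
    using gens assms(1) by auto
  then have js': "sorted_wrt (<) ?js" "0 \<notin> set ?js" by simp_all
  show ?case
    using derivation_gens_sorted[OF js, of s f] derivation_gens_sorted[OF js', of s f] by simp
qed (simp_all add: derivation_add derivation_scale wedge_add_right form.scale_right_distrib mult.commute)

text \<open>The assumption on f says that f i commutes with generators like a form of degree 1 if s
  = 1, and like a form of degree 2 if s = -1. This is the compatibility with e^i e^j = - e^j e^i and
  with e^i e^i = 0. It lets e^i be moved past smaller generators until the rule for a leading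
  generator applies.\<close>

lemma derivation_gen_wedge:
  assumes s: "s * s = 1" and f: "\<And>i j. f i \<^bold>\<and> gen j = - (s \<cdot> (gen j \<^bold>\<and> f i))"
    and "i \<ge> 1"
  shows "derivation s f (gen i \<^bold>\<and> a) = f i \<^bold>\<and> a + s \<cdot> (gen i \<^bold>\<and> derivation s f a)"
proof -
  have f': "f i \<^bold>\<and> gen j \<^bold>\<and> b = - (s \<cdot> (gen j \<^bold>\<and> f i \<^bold>\<and> b))" for i j b
    using arg_cong[OF f[of i j], of "\<lambda>x. x \<^bold>\<and> b"] by (simp add: wedge_assoc)
  have sorted: "derivation s f (gen i \<^bold>\<and> gens js) = f i \<^bold>\<and> gens js + s \<cdot> (gen i \<^bold>\<and> derivation s f (gens js))"
    if "sorted_wrt (<) js" "0 \<notin> set js" for js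
    using that
  proof (induction js)
    case Nil
    then show ?case using \<open>i \<ge> 1\<close> by (simp add: derivation_gen_wedge_above one_form_eq_mon)
  next
    case (Cons j js)
    let ?D = "derivation s f"
    have above: "gens js \<in> forms_on {j<..}" by (rule forms_on_gens) (use Cons in auto)
    have Dj: "?D (gen j \<^bold>\<and> gens js) = f j \<^bold>\<and> gens js + s \<cdot> (gen j \<^bold>\<and> ?D (gens js))"
      by (rule derivation_gen_wedge_above) (use Cons above in auto)
    consider "i < j" | "i = j" | "j < i" by linarith
    then show ?case
    proof cases
      case 1
      then have "gens (j # js) \<in> forms_on {i<..}"
        by (intro forms_on_gens) (use Cons in auto)
      then show ?thesis using \<open>i \<ge> 1\<close> by (intro derivation_gen_wedge_above)
    next
      case 2
      have sq: "gen j \<^bold>\<and> gen j \<^bold>\<and> b = 0" for b :: "'a form" by (metis wedge_assoc gen_wedge_self wedge_zero_left)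
      then have "gen j \<^bold>\<and> ?D (gen j \<^bold>\<and> gens js) = gen j \<^bold>\<and> f j \<^bold>\<and> gens js"
        by (simp add: Dj wedge_add_right)
      then show ?thesis using 2 f'[of j j] sq by simp
    next
      case 3
      have "?D (gen i \<^bold>\<and> gens (j # js)) = - ?D (gen j \<^bold>\<and> gen i \<^bold>\<and> gens js)"
        by (simp add: gen_wedge_gen_wedge_anticomm[of i] derivation_minus)
      also have "?D (gen j \<^bold>\<and> gen i \<^bold>\<and> gens js) =
          f j \<^bold>\<and> gen i \<^bold>\<and> gens js + s \<cdot> (gen j \<^bold>\<and> ?D (gen i \<^bold>\<and> gens js))"
        by (rule derivation_gen_wedge_above)
          (use Cons above 3 in \<open>auto intro!: forms_on_wedge forms_on_gen\<close>)
      also have "?D (gen i \<^bold>\<and> gens js) = f i \<^bold>\<and> gens js + s \<cdot> (gen i \<^bold>\<and> ?D (gens js))"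
        using Cons by simp
      finally show ?thesis using Dj f'[of j i] f'[of i j] s
          gen_wedge_gen_wedge_anticomm[of i j "?D (gens js)"]
        by (simp add: wedge_add_right form.scale_right_distrib form.scale_right_diff_distrib)
    qed
  qed
  show ?thesis
  proof (induction a rule: form_induct_gens)
    case (gens I)
    show ?case by (rule sorted) auto
  qed (simp_all add: derivation_add derivation_scale wedge_add_right form.scale_right_distrib mult.commute)
qed

section \<open>The derivation D_1 and its relation to the differential\<close>

lemma D1_add: "D1 (a + b) = D1 a + D1 b"
  and D1_scale: "D1 (c \<cdot> a) = c \<cdot> D1 a"
  and D1_zero [simp]: "D1 0 = 0"
  by (simp_all add: D1_def derivation_add derivation_scale)

lemma linear_D1: "Vector_Spaces.linear fscale fscale D1"
  by (simp add: D1_def derivation_def linear_lin_ext)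

interpretation D1: Vector_Spaces.linear fscale fscale "D1 :: 'k::field form \<Rightarrow> 'k form"
  by (rule linear_D1)

lemma D1_gen: "D1 (gen i) = (if 3 \<le> i then gen (i - 1) else 0)"
  by (cases "i = 0") (simp_all add: D1_def derivation_gen, simp add: gen_def)

lemma D1_gen_wedge: "D1 (gen i \<^bold>\<and> a) = D1 (gen i) \<^bold>\<and> a + gen i \<^bold>\<and> D1 a"
proof (cases "i = 0")
  case False
  have "D1 (gen i \<^bold>\<and> a) = (if 3 \<le> i then gen (i - 1) else 0) \<^bold>\<and> a + 1 \<cdot> (gen i \<^bold>\<and> D1 a)"
    unfolding D1_def by (rule derivation_gen_wedge) (use False in \<open>auto intro: gen_wedge_anticomm\<close>)
  then show ?thesis by (simp add: D1_gen)
qed (simp add: gen_def)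

lemma D1_one [simp]: "D1 one_form = 0"
  by (simp add: D1_def derivation_def one_form_def)

lemma D1_wedge: "D1 (a \<^bold>\<and> b) = D1 a \<^bold>\<and> b + a \<^bold>\<and> D1 b"
proof (induction a rule: form_induct_gens)
  case (gens I)
  have "D1 (gens is \<^bold>\<and> b) = D1 (gens is) \<^bold>\<and> b + gens is \<^bold>\<and> D1 b" for "is"
    by (induction "is") (simp_all add: wedge_assoc D1_gen_wedge wedge_add_left wedge_add_right)
  then show ?case .
qed (simp_all add: D1_add D1_scale wedge_add_left wedge_add_right form.scale_right_distrib)

lemma diff_gen_wedge: "diff (gen i \<^bold>\<and> a) = diff (gen i) \<^bold>\<and> a - gen i \<^bold>\<and> diff a"
proof (cases "i = 0")
  case False
  have *: "gen j \<^bold>\<and> gen 1 \<^bold>\<and> gen k = (gen 1 \<^bold>\<and> gen k \<^bold>\<and> gen j :: 'a form)" for j k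
    by (subst gen_wedge_gen_wedge_anticomm, subst gen_wedge_anticomm[of j k]) simp
  have "diff (gen i \<^bold>\<and> a) = diff_on_gen i \<^bold>\<and> a + (- 1) \<cdot> (gen i \<^bold>\<and> diff a)"
    unfolding diff_def
    by (rule derivation_gen_wedge) (use False in \<open>auto simp: diff_on_gen_eq wedge_assoc *\<close>)
  moreover have "diff (gen i) = (diff_on_gen i :: 'a form)"
    using False by (simp add: diff_def derivation_gen)
  ultimately show ?thesis by simp
qed (simp add: gen_def diff.zero)

text \<open>Moving e^1 past e^i turns the even product rule of D_1 into the odd one of d, so it
  suffices to compare generators. There d e^i = e^1 e^(i-1) = e^1 D_1(e^i) for i >= 3, and both
  sides are 0 for smaller i.\<close>

lemma diff_eq: "diff a = gen 1 \<^bold>\<and> D1 a"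
proof (induction a rule: form_induct_gens)
  case (gens I)
  have gen: "diff (gen i) = (gen 1 \<^bold>\<and> D1 (gen i) :: 'a form)" for i
  proof -
    consider "i = 0" | "i = 1" | "i = 2" | "3 \<le> i" by linarith
    then show ?thesis
      by cases (simp_all add: D1_gen diff_gen diff_gen_1 diff_gen_2, simp add: gen_def diff.zero)
  qed
  have "diff (gens is) = (gen 1 \<^bold>\<and> D1 (gens is) :: 'a form)" for "is"
  proof (induction "is")
    case Nil
    show ?case by (simp, simp add: diff_def derivation_def one_form_def)
  next
    case (Cons i "is")
    then show ?case
      by (simp add: diff_gen_wedge gen D1_gen_wedge wedge_add_right wedge_assoc
          gen_wedge_gen_wedge_anticomm[of i])
  qed
  then show ?case .
qed (simp_all add: D1_add D1_scale wedge_add_right diff.add diff.scale diff.zero)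

lemma D1_in_subspace:
  assumes "a \<in> forms_with X" "form.subspace V"
    and "\<And>I. X I \<Longrightarrow> D1 (gens (sorted_list_of_set (indices I))) \<in> V"
  shows "D1 a \<in> V"
  using assms(1)
  by (induction a rule: forms_with_induct)
    (use assms in \<open>auto simp: D1_add D1_scale form.subspace_0 form.subspace_add form.subspace_scale\<close>)

lemma D1_Lam:
  fixes a :: "'k::field form"
  shows "a \<in> Lam k \<Longrightarrow> D1 a \<in> Lam k"
  unfolding Lam_eq
proof (erule D1_in_subspace)
  fix I assume I: "int (card (indices I)) = k"
  have "D1 (gens is :: 'k form) \<in> Lam (int (length is))" for "is"
  proof (induction "is")
    case (Cons i "is")
    have "D1 (gen i) \<^bold>\<and> (gens is :: 'k form) \<in> Lam (1 + int (length is))"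
      by (rule Lam_wedge[OF _ Lam_gens]) (simp add: D1_gen Lam_gen, simp add: Lam_def)
    moreover from Cons have "gen i \<^bold>\<and> D1 (gens is :: 'k form) \<in> Lam (1 + int (length is))"
      by (rule Lam_wedge[OF Lam_gen])
    ultimately show ?case by (simp add: D1_gen_wedge Lam_eq forms_with_add)
  qed (simp add: Lam_def)
  from this[of "sorted_list_of_set (indices I)"] I
  show "D1 (gens (sorted_list_of_set (indices I)) :: 'k form) \<in> forms_with (\<lambda>I. int (card (indices I)) = k)"
    by (simp add: Lam_eq)
qed (rule subspace_forms_with)

lemma D1_forms_on:
  fixes a :: "'k::field form"
  assumes "a \<in> forms_on S" "\<And>i. i \<in> S \<Longrightarrow> 3 \<le> i \<Longrightarrow> i - 1 \<in> S"
  shows "D1 a \<in> forms_on S"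
  using assms(1)
proof (rule D1_in_subspace)
  fix I assume I: "indices I \<subseteq> S"
  have "D1 (gens is :: 'k form) \<in> forms_on S" if "set is \<subseteq> S" for "is"
    using that
    by (induction "is") (auto simp: D1_gen_wedge D1_gen
        intro!: assms(2) forms_with_add forms_on_wedge forms_on_gen forms_on_gens)
  then show "D1 (gens (sorted_list_of_set (indices I)) :: 'k form) \<in> forms_on S"
    using I by simp
qed (rule subspace_forms_with)

section \<open>Sign rules for \<open>bar\<close>\<close>

lemma bar_bar [simp]: "bar k (bar k a) = a"
  and bar_add: "bar k (a + b) = bar k a + bar k b"
  and bar_scale: "bar k (c \<cdot> a) = c \<cdot> bar k a"
  and bar_zero [simp]: "bar k 0 = 0"
  by (simp_all add: bar_def)

lemma gen_wedge_Lam: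
  assumes "a \<in> Lam k"
  shows "gen i \<^bold>\<and> a = - (bar k a \<^bold>\<and> gen i)"
  using assms unfolding Lam_eq
proof (induction a rule: forms_with_induct)
  case (gens I)
  have "gen i \<^bold>\<and> gens is = - (bar (int (length is)) (gens is :: 'a form) \<^bold>\<and> gen i)" for "is"
  proof (induction "is")
    case (Cons j "is")
    have "gen i \<^bold>\<and> gen j \<^bold>\<and> (gens is :: 'a form) = gen j \<^bold>\<and> bar (int (length is)) (gens is) \<^bold>\<and> gen i"
      by (simp only: gen_wedge_gen_wedge_anticomm[of i j] Cons wedge_minus_right minus_minus)
    then show ?case by (simp add: bar_def wedge_assoc)
  qed (simp add: bar_def)
  from this[of "sorted_list_of_set (indices I)"] gens show ?case by simp
qed (simp_all add: bar_add bar_scale wedge_add_left wedge_add_right)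

text \<open>The Leibniz rule with its sign absorbed: e^1 passing \<open>bar k a\<close> removes the
  bar and leaves one minus sign, whatever the parity of k. In this form the two double sums in
  \<open>diff_massey_sum\<close> cancel without a case distinction on degrees.\<close>

lemma diff_bar_wedge:
  assumes "a \<in> Lam k"
  shows "diff (bar k a \<^bold>\<and> b) = diff (bar k a) \<^bold>\<and> b - a \<^bold>\<and> diff b"
proof -
  have "bar k a \<in> Lam k" using assms by (simp add: bar_def Lam_eq forms_with_neg)
  then have "gen 1 \<^bold>\<and> bar k a = - (a \<^bold>\<and> gen 1)"
    by (simp add: gen_wedge_Lam)
  then have "gen 1 \<^bold>\<and> bar k a \<^bold>\<and> c = - (a \<^bold>\<and> gen 1 \<^bold>\<and> c)" for c
    by (metis wedge_assoc wedge_minus_left)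
  then show ?thesis by (simp add: diff_eq D1_wedge wedge_add_right wedge_assoc)
qed

section \<open>The cocycles $\omega$\<close>

lemma D1_pow_add: "(D1 ^^ l) (a + b) = (D1 ^^ l) a + (D1 ^^ l) b"
  and D1_pow_scale: "(D1 ^^ l) (c \<cdot> a) = c \<cdot> (D1 ^^ l) a"
  and D1_pow_zero [simp]: "(D1 ^^ l) 0 = 0"
  by (induction l) (simp_all add: D1_add D1_scale)

lemma D1_pow_Suc: "(D1 ^^ Suc l) a = (D1 ^^ l) (D1 a)"
  by (simp add: funpow_swap1)

lemma D1_pow_eq_0_mono: "(D1 ^^ L) a = 0 \<Longrightarrow> L \<le> M \<Longrightarrow> (D1 ^^ M) a = 0"
  using fun_cong[OF funpow_add[of "M - L" L D1], of a] by simp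

text \<open>In the Leibniz expansion each summand has at least L derivatives on a or at least M on
  b.\<close>

lemma D1_pow_wedge_eq_0:
  "(D1 ^^ L) a = 0 \<Longrightarrow> (D1 ^^ M) b = 0 \<Longrightarrow> (D1 ^^ (L + M)) (a \<^bold>\<and> b) = 0"
proof (induction "L + M" arbitrary: L M a b)
  case (Suc n)
  show ?case
  proof (cases "L = 0 \<or> M = 0")
    case True
    then show ?thesis using Suc.prems by auto
  next
    case False
    then obtain L' M' where LM: "L = Suc L'" "M = Suc M'" by (metis not0_implies_Suc)
    have "(D1 ^^ (L' + M)) (D1 a \<^bold>\<and> b) = 0"
      by (rule Suc.hyps(1)) (use Suc LM in \<open>auto simp: D1_pow_Suc simp del: funpow.simps\<close>)
    moreover have "(D1 ^^ (L + M')) (a \<^bold>\<and> D1 b) = 0"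
      by (rule Suc.hyps(1)) (use Suc LM in \<open>auto simp: D1_pow_Suc simp del: funpow.simps\<close>)
    moreover have "L + M = Suc (L' + M)" "L + M' = L' + M" using LM by auto
    ultimately show ?thesis by (simp only: D1_pow_Suc D1_wedge D1_pow_add) simp
  qed
qed simp

lemma D1_pow_gen_eq_0: "(D1 ^^ i) (gen i) = 0"
proof (induction i)
  case 0
  show ?case by (simp add: gen_def)
next
  case (Suc i)
  then show ?case by (simp only: D1_pow_Suc D1_gen) simp
qed

text \<open>D_1 lowers indices and kills e^2, so e^i dies after i steps, and products by the
  preceding bound. There is no uniform exponent; each form has its own, and this makes the sums
  defining omega finite.\<close>

lemma D1_locally_nilpotent: "\<exists>L. (D1 ^^ L) a = 0"
proof (induction a rule: form_induct_gens)
  case (gens I)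
  have "\<exists>L. (D1 ^^ L) (gens is :: 'a form) = 0" for "is"
  proof (induction "is")
    case Nil
    have "(D1 ^^ 1) (gens [] :: 'a form) = 0" by (simp add: One_nat_def)
    then show ?case by blast
  next
    case (Cons i "is")
    then show ?case using D1_pow_wedge_eq_0[OF D1_pow_gen_eq_0[of i]] by fastforce
  qed
  then show ?case .
next
  case (add a b)
  then obtain L M where "(D1 ^^ L) a = 0" "(D1 ^^ M) b = 0" by blast
  then have "(D1 ^^ max L M) (a + b) = 0"
    by (simp add: D1_pow_add D1_pow_eq_0_mono[of L a] D1_pow_eq_0_mono[of M b])
  then show ?case by blast
qed (auto simp: D1_pow_scale)

text \<open>Here xi and n vary independently, so that the passage from (xi, n) to (D_1 xi, n + 1),
  on which the inductions run, stays inside the family. \<open>omega\<close> ties n to the last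
  index of xi.\<close>

definition omega_ext :: "'k::field form \<Rightarrow> nat \<Rightarrow> 'k form"
  where "omega_ext \<xi> n = (\<Sum>l | (D1 ^^ l) \<xi> \<noteq> 0. (- 1) ^ l \<cdot> ((D1 ^^ l) \<xi> \<^bold>\<and> gen (n + l)))"

text \<open>
  For \<open>D\<^sub>1\<^sup>L \<xi> = 0\<close>, \<open>omega_iter L t \<xi> n\<close> is the sum over \<open>u\<close> of
  \<open>(-1)\<^sup>u (u + t choose t) D\<^sub>1\<^sup>u \<xi> \<and> e\<^sup>n\<^sup>+\<^sup>t\<^sup>+\<^sup>u\<close>; the recursion is Pascal's rule.
\<close>

fun omega_iter :: "nat \<Rightarrow> nat \<Rightarrow> 'k::field form \<Rightarrow> nat \<Rightarrow> 'k form"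
  where
    "omega_iter 0 t \<xi> n = 0"
  | "omega_iter (Suc L) 0 \<xi> n = \<xi> \<^bold>\<and> gen n - omega_iter L 0 (D1 \<xi>) (Suc n)"
  | "omega_iter (Suc L) (Suc t) \<xi> n =
      omega_iter (Suc L) t \<xi> (Suc n) - omega_iter L (Suc t) (D1 \<xi>) (Suc n)"

lemma omega_iter_0_eq_sum:
  "omega_iter L 0 \<xi> n = (\<Sum>l<L. (- 1) ^ l \<cdot> ((D1 ^^ l) \<xi> \<^bold>\<and> gen (n + l)))"
proof (induction L arbitrary: \<xi> n)
  case (Suc L)
  show ?case
    unfolding sum.lessThan_Suc_shift
    by (simp add: Suc D1_pow_Suc sum_negf del: funpow.simps)
qed simp

lemma omega_ext_eq_omega_iter:
  assumes "(D1 ^^ L) \<xi> = 0"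
  shows "omega_ext \<xi> n = omega_iter L 0 \<xi> n"
  unfolding omega_ext_def omega_iter_0_eq_sum
proof (rule sum.mono_neutral_left)
  show "{l. (D1 ^^ l) \<xi> \<noteq> 0} \<subseteq> {..<L}"
    using D1_pow_eq_0_mono[OF assms] leI by blast
qed auto

lemma omega_iter_add: "omega_iter L t (a + b) n = omega_iter L t a n + omega_iter L t b n"
  and omega_iter_scale: "omega_iter L t (c \<cdot> a) n = c \<cdot> omega_iter L t a n"
  by (induction L t a n arbitrary: b rule: omega_iter.induct)
    (simp_all add: D1_add D1_scale wedge_add_left form.scale_right_diff_distrib)

lemma omega_ext_zero [simp]: "omega_ext 0 n = 0"
  by (simp add: omega_ext_def)

lemma omega_ext_add: "omega_ext (a + b) n = omega_ext a n + omega_ext b n"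
proof -
  obtain L M where "(D1 ^^ L) a = 0" "(D1 ^^ M) b = 0" using D1_locally_nilpotent by blast
  then have "(D1 ^^ (L + M)) a = 0" "(D1 ^^ (L + M)) b = 0"
    using D1_pow_eq_0_mono by (metis le_add1, metis le_add2)
  then show ?thesis
    by (simp add: omega_ext_eq_omega_iter[of "L + M"] D1_pow_add omega_iter_add)
qed

lemma omega_ext_scale: "omega_ext (c \<cdot> a) n = c \<cdot> omega_ext a n"
proof -
  obtain L where "(D1 ^^ L) a = 0" using D1_locally_nilpotent by blast
  then show ?thesis
    by (simp add: omega_ext_eq_omega_iter[of L] D1_pow_scale omega_iter_scale)
qed

lemma omega_ext_rec: "omega_ext \<xi> n = \<xi> \<^bold>\<and> gen n - omega_ext (D1 \<xi>) (Suc n)"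
proof -
  obtain L where "(D1 ^^ L) \<xi> = 0" using D1_locally_nilpotent by blast
  then have "(D1 ^^ Suc L) \<xi> = 0" "(D1 ^^ L) (D1 \<xi>) = 0"
    by (simp, simp flip: funpow_swap1)
  then show ?thesis by (simp add: omega_ext_eq_omega_iter[of "Suc L" \<xi>] omega_ext_eq_omega_iter[of L "D1 \<xi>"] del: funpow.simps)
qed

text \<open>Induction on the nilpotency exponent of xi. Together with \<open>omega_ext_rec\<close>
  it replaces manipulations of the alternating sum.\<close>

lemma omega_ext_induct [case_names zero step]:
  assumes "P 0" "\<And>\<xi>. P (D1 \<xi>) \<Longrightarrow> P \<xi>"
  shows "P \<xi>"
proof -
  obtain L where "(D1 ^^ L) \<xi> = 0" using D1_locally_nilpotent by blast
  then show ?thesis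
    by (induction L arbitrary: \<xi>) (auto simp: funpow_swap1 intro: assms)
qed

text \<open>The sum telescopes: D_1(xi e^n) = (D_1 xi) e^n + xi e^(n-1), and the first term cancels
  against D_1 of the tail. The bound n >= 3 is the range in which D_1 e^n = e^(n-1) is
  nonzero.\<close>

lemma D1_omega_ext:
  assumes "n \<ge> 3"
  shows "D1 (omega_ext \<xi> n) = \<xi> \<^bold>\<and> gen (n - 1)"
  using assms
proof (induction \<xi> arbitrary: n rule: omega_ext_induct)
  case (step \<xi>)
  have "D1 (omega_ext (D1 \<xi>) (Suc n)) = D1 \<xi> \<^bold>\<and> gen n" using step by simp
  then show ?case using \<open>n \<ge> 3\<close> by (subst omega_ext_rec) (simp add: D1.diff D1_wedge D1_gen)
qed simp

text \<open>Raising t by one is a D_1-antiderivative: D_1 lowers t in both terms of the Pascal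
  recursion, and t = 0 reduces to \<open>D1_omega_ext\<close>. That lemma is applied at n + 1, so n
  >= 2 is enough.\<close>

lemma D1_omega_iter:
  assumes "(D1 ^^ L) \<xi> = 0" "n \<ge> 2"
  shows "D1 (omega_iter L (Suc t) \<xi> n) = omega_iter L t \<xi> n"
  using assms
proof (induction L arbitrary: \<xi> n t)
  case (Suc L)
  note outer_IH = Suc.IH
  note nil = \<open>(D1 ^^ Suc L) \<xi> = 0\<close>
  have nil': "(D1 ^^ L) (D1 \<xi>) = 0" using nil by (simp add: funpow_swap1)
  show ?case
    using \<open>n \<ge> 2\<close>
  proof (induction t arbitrary: n)
    case 0
    have "D1 (omega_iter (Suc L) 0 \<xi> (Suc n)) = \<xi> \<^bold>\<and> gen n"
      using D1_omega_ext[of "Suc n" \<xi>] omega_ext_eq_omega_iter[OF nil] 0 by simp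
    then show ?case using Suc.IH[OF nil', of "Suc n" 0] 0 by (simp add: D1.diff)
  next
    case (Suc t)
    then show ?case
      using Suc.IH[of "Suc n"] outer_IH[OF nil', of "Suc n" "Suc t"]
      by (subst omega_iter.simps(3)) (simp add: D1.diff del: omega_iter.simps(3), simp)
  qed
qed simp

text \<open>The summands of the left side are grouped by the number t of derivatives that fall on
  e^i. The sum stops at t = i - 2, where e^i has become e^2. The right side has the shape of a
  related cocycle whose last column holds the antiderivatives.\<close>

lemma omega_ext_gen_wedge:
  assumes "(D1 ^^ L) \<xi> = 0" "2 \<le> i"
  shows "omega_ext (gen i \<^bold>\<and> \<xi>) n = (\<Sum>t<i - 1. (- 1) ^ t \<cdot> (gen (i - t) \<^bold>\<and> omega_iter L t \<xi> n))"
  using assms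
proof (induction L arbitrary: \<xi> n i)
  case (Suc L)
  note IH = Suc.IH
  note nil = \<open>(D1 ^^ Suc L) \<xi> = 0\<close>
  have nil': "(D1 ^^ L) (D1 \<xi>) = 0" using nil by (simp add: funpow_swap1)
  show ?case
    using \<open>2 \<le> i\<close>
  proof (induction i arbitrary: n rule: nat_induct_at_least)
    case base
    have "omega_ext (gen 2 \<^bold>\<and> \<xi>) n = gen 2 \<^bold>\<and> \<xi> \<^bold>\<and> gen n - omega_ext (gen 2 \<^bold>\<and> D1 \<xi>) (Suc n)"
      by (subst omega_ext_rec) (simp add: D1_wedge D1_gen wedge_assoc)
    then show ?case using IH[OF nil', of 2 "Suc n"]
      by (simp add: numeral_2_eq_2 One_nat_def wedge_add_right diff_conv_add_uminus del: add_uminus_conv_diff)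
  next
    case (Suc i)
    \<comment> \<open>The first derivative falls either on the generator or on xi. The resulting two
      sums, the former shifted by one in t, recombine by the recursion of
      \<open>omega_iter\<close>.\<close>
    have "omega_ext (gen (Suc i) \<^bold>\<and> \<xi>) n = gen (Suc i) \<^bold>\<and> \<xi> \<^bold>\<and> gen n - omega_ext (gen i \<^bold>\<and> \<xi>) (Suc n)
        - omega_ext (gen (Suc i) \<^bold>\<and> D1 \<xi>) (Suc n)"
      using Suc.hyps by (subst omega_ext_rec) (simp add: D1_wedge D1_gen wedge_assoc omega_ext_add)
    also have "omega_ext (gen i \<^bold>\<and> \<xi>) (Suc n) =
        (\<Sum>t<i - 1. (- 1) ^ t \<cdot> (gen (i - t) \<^bold>\<and> omega_iter (Suc L) t \<xi> (Suc n)))"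
      by (rule Suc.IH)
    also have "omega_ext (gen (Suc i) \<^bold>\<and> D1 \<xi>) (Suc n) =
        (\<Sum>t<Suc (i - 1). (- 1) ^ t \<cdot> (gen (Suc i - t) \<^bold>\<and> omega_iter L t (D1 \<xi>) (Suc n)))"
      using IH[OF nil', of "Suc i" "Suc n"] Suc.hyps by simp
    finally have "omega_ext (gen (Suc i) \<^bold>\<and> \<xi>) n =
      (\<Sum>t<Suc (i - 1). (- 1) ^ t \<cdot> (gen (Suc i - t) \<^bold>\<and> omega_iter (Suc L) t \<xi> n))"
      unfolding sum.lessThan_Suc_shift
      by (simp add: wedge_add_right diff_conv_add_uminus form.scale_right_distrib sum.distrib sum_negf
           del: add_uminus_conv_diff)
    then show ?case using Suc.hyps by simp
  qed
qed simp

lemma omega_iter_Lam: "\<xi> \<in> Lam k \<Longrightarrow> omega_iter L t \<xi> n \<in> Lam (k + 1)"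
  by (induction L t \<xi> n rule: omega_iter.induct)
    (auto simp: Lam_eq[of "k + 1"] D1_Lam intro!: forms_with_diff Lam_wedge[unfolded Lam_eq[of "_ + _"]] Lam_gen)

section \<open>Closedness of the omega forms and a right inverse of D_1\<close>

lemma omega_eq_omega_ext: "omega is = omega_ext (gens is) (last is + 1)"
  by (simp add: omega_def omega_ext_def)

lemma gens_wedge_gen_last: "is \<noteq> [] \<Longrightarrow> gens is \<^bold>\<and> gen (last is) = 0"
  by (induction "is" rule: rev_induct) (simp_all add: gens_append wedge_assoc)

text \<open>This is why the last factor has index i_q + 1: the telescoped sum leaves e^(i_1) ...
  e^(i_q) e^(i_q), with a repeated factor.\<close>

lemma D1_omega: "is \<noteq> [] \<Longrightarrow> 2 \<le> last is \<Longrightarrow> D1 (omega is) = 0"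
  by (simp add: omega_eq_omega_ext D1_omega_ext gens_wedge_gen_last)

lemma diff_omega: "is \<noteq> [] \<Longrightarrow> 2 \<le> last is \<Longrightarrow> diff (omega is) = 0"
  by (simp add: diff_eq D1_omega)

definition D1_inverse :: "'k::field form \<Rightarrow> 'k form"
  where "D1_inverse = lin_ext (\<lambda>I. let is = sorted_list_of_set (indices I)
    in omega_ext (gens (butlast is)) (last is + 1))"

lemma D1_inverse_add: "D1_inverse (a + b) = D1_inverse a + D1_inverse b"
  and D1_inverse_scale: "D1_inverse (c \<cdot> a) = c \<cdot> D1_inverse a"
  and D1_inverse_zero [simp]: "D1_inverse 0 = 0"
  by (simp_all add: D1_inverse_def lin_ext_add lin_ext_scale)

lemma D1_inverse_gens:
  assumes "sorted_wrt (<) is" "0 \<notin> set is"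
  shows "D1_inverse (gens is) = omega_ext (gens (butlast is)) (last is + 1)"
proof -
  have "sorted_list_of_set (set is) = is"
    using assms by (simp add: sorted_list_of_set.idem_if_sorted_distinct strict_sorted_iff)
  then show ?thesis using assms by (simp add: gens_sorted D1_inverse_def)
qed

text \<open>The defining formula holds for sums xi of monomials too, which is needed because
  \<open>D1_inverse\<close> is applied to (D_1 xi) e^n.\<close>

lemma D1_inverse_wedge_gen:
  assumes "\<xi> \<in> forms_on {..<n}" "n \<ge> 1"
  shows "D1_inverse (\<xi> \<^bold>\<and> gen n) = omega_ext \<xi> (n + 1)"
  using assms(1)
proof (induction \<xi> rule: forms_with_induct)
  case (gens I)
  let ?is = "sorted_list_of_set (indices I)"
  have "D1_inverse (gens (?is @ [n])) = omega_ext (gens ?is) (n + 1)"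
    by (subst D1_inverse_gens) (use gens assms(2) in \<open>auto simp: sorted_wrt_append\<close>)
  then show ?case by (simp add: gens_append)
qed (simp_all add: wedge_add_left D1_inverse_add D1_inverse_scale omega_ext_add omega_ext_scale)

section \<open>Cohomology in positive degrees\<close>

text \<open>For a monomial with last index n >= 2 this is \<open>D1_omega_ext\<close> at n + 1.
  Constants must be excluded: D_1 preserves degree and kills degree 0.\<close>

lemma D1_D1_inverse:
  assumes "a \<in> forms_with (\<lambda>I. indices I \<subseteq> {2..} \<and> indices I \<noteq> {})"
  shows "D1 (D1_inverse a) = a"
  using assms
proof (induction a rule: forms_with_induct)
  case (gens I)
  let ?is = "sorted_list_of_set (indices I)"
  have ne: "?is \<noteq> []" and set: "set ?is \<subseteq> {2..}" using gens by auto
  then have "2 \<le> last ?is" using last_in_set by blast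
  then have "D1 (omega_ext (gens (butlast ?is)) (last ?is + 1)) = gens (butlast ?is) \<^bold>\<and> (gen (last ?is) :: 'a form)"
    by (simp add: D1_omega_ext)
  also have "\<dots> = gens ?is"
    using gens_append[of "butlast ?is" "[last ?is]", where 'a = 'a] ne by simp
  finally show ?case by (simp add: D1_inverse_gens)
qed (simp_all add: D1_inverse_add D1_inverse_scale D1_add D1_scale)

definition omega_index :: "nat list \<Rightarrow> bool"
  where "omega_index is \<longleftrightarrow> is \<noteq> [] \<and> sorted_wrt (<) is \<and> (\<forall>i\<in>set is. 2 \<le> i)"

lemma omega_index_last: "omega_index is \<Longrightarrow> 2 \<le> last is"
  by (simp add: omega_index_def)

text \<open>For a monomial xi e^n one has D_1(xi e^n) = (D_1 xi) e^n + xi e^(n-1). The inverse sends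
  the first term to \<open>omega_ext (D1 xi) (n + 1)\<close>. If xi ends below n - 1, it sends the
  second to \<open>omega_ext xi n\<close>, and by \<open>omega_ext_rec\<close> the total is xi e^n,
  leaving 0. If xi ends at n - 1, the second term vanishes and the difference is
  \<open>omega_ext xi n\<close>, a cocycle omega.\<close>

lemma sub_D1_inverse_D1_in_span:
  assumes "a \<in> forms_with (\<lambda>I. indices I \<subseteq> {2..} \<and> card (indices I) = Suc q)" "q \<ge> 1"
  shows "a - D1_inverse (D1 a) \<in> form.span {omega js | js. omega_index js \<and> length js = q}"
  using assms(1)
proof (induction a rule: forms_with_induct)
  case (gens I)
  define js n where "js = butlast (sorted_list_of_set (indices I))"
    and "n = last (sorted_list_of_set (indices I))"
  have len: "length js = q" using gens by (simp add: js_def)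
  then have "js \<noteq> []" using assms(2) by auto
  have is_eq: "sorted_list_of_set (indices I) = js @ [n]"
    using \<open>js \<noteq> []\<close> unfolding js_def n_def by (metis append_butlast_last_id butlast.simps(1))
  have "sorted_wrt (<) (js @ [n])" by (metis is_eq strict_sorted_list_of_set)
  then have sorted: "sorted_wrt (<) js" "\<forall>j\<in>set js. j < n" by (auto simp: sorted_wrt_append)
  have "set (js @ [n]) = indices I" by (metis is_eq finite_indices set_sorted_list_of_set)
  then have ge2: "\<forall>j\<in>set js. 2 \<le> j" using gens by auto
  have "last js < n" "2 \<le> last js" using sorted ge2 \<open>js \<noteq> []\<close> by auto
  have "gens js \<in> forms_on {..<n}" by (rule forms_on_gens) (use sorted in auto)
  moreover from this have "D1 (gens js :: 'a form) \<in> forms_on {..<n}" by (rule D1_forms_on) auto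
  ultimately have QD: "D1_inverse (D1 (gens js) \<^bold>\<and> gen n) = omega_ext (D1 (gens js :: 'a form)) (n + 1)"
    using \<open>last js < n\<close> by (intro D1_inverse_wedge_gen) auto
  have D: "D1 (gens js \<^bold>\<and> gen n) = D1 (gens js) \<^bold>\<and> gen n + (gens js :: 'a form) \<^bold>\<and> gen (n - 1)"
    using \<open>last js < n\<close> \<open>2 \<le> last js\<close> by (simp add: D1_wedge D1_gen)
  have omega_ext: "omega_ext (gens js :: 'a form) n = gens js \<^bold>\<and> gen n - omega_ext (D1 (gens js)) (n + 1)"
    using omega_ext_rec[of "gens js :: 'a form" n] by (simp only: Suc_eq_plus1)
  show ?case
  proof (cases "last js = n - 1")
    case True
    have "omega js = omega_ext (gens js :: 'a form) n"
      using True \<open>last js < n\<close> by (simp add: omega_eq_omega_ext)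
    then have "gens (js @ [n]) - D1_inverse (D1 (gens (js @ [n]))) = (omega js :: 'a form)"
      using gens_wedge_gen_last[OF \<open>js \<noteq> []\<close>, where 'a = 'a] True omega_ext QD
      by (simp add: gens_append D D1_inverse_add)
    then show ?thesis
      unfolding is_eq using \<open>js \<noteq> []\<close> sorted ge2 len
      by (auto intro!: form.span_base simp: omega_index_def)
  next
    case False
    obtain ks m where "js = ks @ [m]" using \<open>js \<noteq> []\<close> by (cases js rule: rev_cases) auto
    then have "\<forall>j\<in>set js. j \<le> last js" using sorted(1) by (auto simp: sorted_wrt_append less_imp_le)
    then have "gens js \<in> forms_on {..<n - 1}"
      using False \<open>last js < n\<close> by (intro forms_on_gens) force
    then have "D1_inverse (gens js \<^bold>\<and> gen (n - 1)) = omega_ext (gens js :: 'a form) n"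
      using \<open>last js < n\<close> \<open>2 \<le> last js\<close> by (subst D1_inverse_wedge_gen) auto
    then have "gens (js @ [n]) - D1_inverse (D1 (gens (js @ [n]))) = (0 :: 'a form)"
      using omega_ext QD by (simp add: gens_append D D1_inverse_add)
    then show ?thesis unfolding is_eq by (simp add: form.span_zero)
  qed
next
  case (add a b)
  then show ?case
    by (metis (no_types, lifting) D1_add D1_inverse_add add_diff_add form.span_add)
next
  case (scale c a)
  then show ?case
    by (simp add: D1_scale D1_inverse_scale form.span_scale flip: form.scale_right_diff_distrib)
qed (simp add: form.span_zero)

lemma gen_1_decomposition:
  assumes "a \<in> Lam q"
  obtains a0 a1 where "a = a0 + gen 1 \<^bold>\<and> a1"
    "a0 \<in> forms_with (\<lambda>I. indices I \<subseteq> {2..} \<and> int (card (indices I)) = q)"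
    "a1 \<in> forms_with (\<lambda>I. indices I \<subseteq> {2..} \<and> int (card (indices I)) = q - 1)"
proof -
  have "\<exists>a0 a1. a = a0 + gen 1 \<^bold>\<and> a1 \<and>
    a0 \<in> forms_with (\<lambda>I. indices I \<subseteq> {2..} \<and> int (card (indices I)) = q) \<and>
    a1 \<in> forms_with (\<lambda>I. indices I \<subseteq> {2..} \<and> int (card (indices I)) = q - 1)"
    using assms unfolding Lam_eq
  proof (induction a rule: forms_with_induct)
    case (gens I)
    have ge1: "x \<ge> 1" if "x \<in> indices I" for x
      using that zero_notin_indices[of I] by (cases x) (auto simp: One_nat_def)
    show ?case
    proof (cases "1 \<in> indices I")
      case True
      let ?J = "Ixset (indices I - {1})"
      have J: "indices ?J = indices I - {1}" by simp
      have "{j \<in> indices ?J. j < 1} = {}" using ge1 J by fastforce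
      then have card: "card {j \<in> indices ?J. j < 1} = 0" by (simp only: card.empty)
      then have "mon I = gen 1 \<^bold>\<and> (mon ?J :: 'a form)"
        using True unfolding gen_wedge_mon[OF order_refl] card
        by (simp add: insert_absorb indices_inverse)
      moreover have "x \<ge> 2" if "x \<in> indices I - {1}" for x using ge1[of x] that by auto
      then have "(mon ?J :: 'a form) \<in> forms_with (\<lambda>I. indices I \<subseteq> {2..} \<and> int (card (indices I)) = q - 1)"
        using gens True J card_Suc_Diff1[OF finite_indices True] by auto
      ultimately show ?thesis
        unfolding mon_eq_gens[symmetric] by (intro exI[of _ 0] exI[of _ "mon ?J"] conjI) simp_all
    next
      case False
      have "x \<ge> 2" if "x \<in> indices I" for x using ge1[of x] that False by (cases "x = 1") auto
      then have "mon I \<in> forms_with (\<lambda>I. indices I \<subseteq> {2..} \<and> int (card (indices I)) = q)"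
        using gens by auto
      then show ?thesis
        unfolding mon_eq_gens[symmetric] by (intro exI[of _ "mon I"] exI[of _ 0] conjI) simp_all
    qed
  next
    case zero
    show ?case by (intro exI[of _ 0]) simp
  next
    case (add a b)
    then obtain a0 a1 b0 b1 where "a = a0 + gen 1 \<^bold>\<and> a1" "b = b0 + gen 1 \<^bold>\<and> b1"
      "a0 \<in> forms_with (\<lambda>I. indices I \<subseteq> {2..} \<and> int (card (indices I)) = q)"
      "b0 \<in> forms_with (\<lambda>I. indices I \<subseteq> {2..} \<and> int (card (indices I)) = q)"
      "a1 \<in> forms_with (\<lambda>I. indices I \<subseteq> {2..} \<and> int (card (indices I)) = q - 1)"
      "b1 \<in> forms_with (\<lambda>I. indices I \<subseteq> {2..} \<and> int (card (indices I)) = q - 1)"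
      by blast
    then show ?case
      by (intro exI[of _ "a0 + b0"] exI[of _ "a1 + b1"]) (auto simp: wedge_add_right forms_with_add)
  next
    case (scale c a)
    then obtain a0 a1 where "a = a0 + gen 1 \<^bold>\<and> a1"
      "a0 \<in> forms_with (\<lambda>I. indices I \<subseteq> {2..} \<and> int (card (indices I)) = q)"
      "a1 \<in> forms_with (\<lambda>I. indices I \<subseteq> {2..} \<and> int (card (indices I)) = q - 1)"
      by blast
    then show ?case
      by (intro exI[of _ "c \<cdot> a0"] exI[of _ "c \<cdot> a1"])
        (auto simp: forms_with_scale form.scale_right_distrib)
  qed
  then show thesis using that by blast
qed

lemma gen_1_wedge_eq_0:
  assumes "b \<in> forms_on {2..}" "gen 1 \<^bold>\<and> b = 0"
  shows "b = 0"
proof (rule poly_mapping_eqI)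
  fix J
  show "Poly_Mapping.lookup b J = Poly_Mapping.lookup 0 J"
  proof (cases "J \<in> Poly_Mapping.keys b")
    case True
    then have "1 \<notin> indices J" using assms(1) by (force simp: forms_with_def)
    moreover have "Poly_Mapping.lookup (gen 1 \<^bold>\<and> b) (Ixset (insert 1 (indices J))) = 0"
      using assms(2) by simp
    ultimately show ?thesis by (simp add: lookup_gen_wedge indices_inverse)
  qed (simp add: in_keys_iff)
qed

lemma lookup_diff: "1 \<notin> indices I \<Longrightarrow> Poly_Mapping.lookup (diff x) I = 0"
  by (simp add: diff_eq lookup_gen_wedge)

lemma forms_with_mono: "a \<in> forms_with X \<Longrightarrow> (\<And>I. X I \<Longrightarrow> Y I) \<Longrightarrow> a \<in> forms_with Y"
  by (auto simp: forms_with_def)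

lemma diff_eq_0_iff:
  assumes "a0 \<in> forms_on {2..}"
  shows "diff (a0 + gen 1 \<^bold>\<and> a1) = 0 \<longleftrightarrow> D1 a0 = 0"
proof -
  have [simp]: "gen 1 \<^bold>\<and> gen 1 \<^bold>\<and> b = 0" for b :: "'a form"
    by (metis wedge_assoc gen_wedge_self wedge_zero_left)
  have "diff (a0 + gen 1 \<^bold>\<and> a1) = gen 1 \<^bold>\<and> D1 a0"
    by (simp add: diff_eq D1_add D1_wedge D1_gen wedge_add_right)
  moreover have "D1 a0 \<in> forms_on {2..}" using assms by (rule D1_forms_on) auto
  ultimately show ?thesis using gen_1_wedge_eq_0 by auto
qed

section \<open>Cohomology classes of closed forms and spanning sets\<close>

lemma cls_eq_iff:
  assumes "diff a = 0" "diff b = 0"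
  shows "cls a = cls b \<longleftrightarrow> (\<exists>x. a - b = diff x)"
  using assms Quotient_rel[OF Quotient_coho, of a b]
  by (auto simp: cohomologous_def intro: exI[of _ 0])

lemma cls_eq_0_iff: "diff a = 0 \<Longrightarrow> cls a = 0 \<longleftrightarrow> (\<exists>x. a = diff x)"
  unfolding zero_coho_def by (subst cls_eq_iff) auto

lemma cohomologous_self: "diff a = 0 \<Longrightarrow> cohomologous a a"
  by (auto simp: cohomologous_def intro: exI[of _ 0])

lemma cls_add: "diff a = 0 \<Longrightarrow> diff b = 0 \<Longrightarrow> cls (a + b) = cls a + cls b"
  by (simp add: plus_coho.abs_eq cohomologous_self)

lemma cls_scale: "diff a = 0 \<Longrightarrow> cls (c \<cdot> a) = c \<cdot>\<^sub>H cls a"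
  by (simp add: coho_scale.abs_eq cohomologous_self)

lemma cls_span:
  assumes "a \<in> form.span B" "\<And>b. b \<in> B \<Longrightarrow> diff b = 0"
  shows "cls a \<in> coho.span (cls ` B)"
proof -
  \<comment> \<open>\<open>cls\<close> is additive only on closed forms, so closedness is carried
    through the induction.\<close>
  have "diff a = 0 \<and> cls a \<in> coho.span (cls ` B)"
    using assms(1)
  proof (induction rule: form.span_induct_alt)
    case base
    then show ?case by (simp add: coho.span_zero flip: zero_coho_def)
  next
    case (step c x y)
    then show ?case
      by (simp add: assms(2) diff.add diff.scale cls_add cls_scale coho.span_add coho.span_scale coho.span_base)
  qed
  then show ?thesis ..
qed

lemma subspace_H: "coho.subspace (H q)"
  unfolding coho.subspace_def
proof (intro conjI ballI allI)
  show "0 \<in> H q" unfolding H_def zero_coho_def by (auto simp: Lam_eq intro!: exI[of _ 0])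
next
  fix x y :: "'a coho" assume "x \<in> H q" "y \<in> H q"
  then show "x + y \<in> H q"
    unfolding H_def by (auto simp: Lam_eq diff.add simp flip: cls_add intro!: forms_with_add)
next
  fix c x assume "x \<in> H q"
  then show "c \<cdot>\<^sub>H x \<in> H q"
    unfolding H_def by (auto simp: Lam_eq diff.scale simp flip: cls_scale intro!: forms_with_scale)
qed

lemma H_subset_span_omega:
  assumes "q \<ge> 1"
  shows "H (int q + 1) \<subseteq> coho.span {cls (omega js) | js. omega_index js \<and> length js = q}"
proof
  fix x assume "x \<in> (H (int q + 1) :: 'a coho set)"
  then obtain a :: "'a form" where a: "x = cls a" "a \<in> Lam (int q + 1)" "diff a = 0"
    by (auto simp: H_def)
  from a(2) obtain a0 a1 where a01: "a = a0 + gen 1 \<^bold>\<and> a1"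
    "a0 \<in> forms_with (\<lambda>I. indices I \<subseteq> {2..} \<and> int (card (indices I)) = int q + 1)"
    "a1 \<in> forms_with (\<lambda>I. indices I \<subseteq> {2..} \<and> int (card (indices I)) = int q + 1 - 1)"
    by (rule gen_1_decomposition)
  have "a0 \<in> forms_on {2..}" using a01(2) by (rule forms_with_mono) simp
  then have D: "D1 a0 = 0" using a(3) a01(1) diff_eq_0_iff by blast
  have "a0 \<in> forms_with (\<lambda>I. indices I \<subseteq> {2..} \<and> card (indices I) = Suc q)"
    using a01(2) by (rule forms_with_mono) auto
  then have "a0 \<in> form.span {omega js | js. omega_index js \<and> length js = q}"
    using sub_D1_inverse_D1_in_span[OF _ assms] D by fastforce
  then have "cls a0 \<in> coho.span (cls ` {omega js | js. omega_index js \<and> length js = q})"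
    by (rule cls_span) (auto intro!: diff_omega omega_index_last simp: omega_index_def)
  \<comment> \<open>Since q >= 1, a1 has positive degree and so has a D_1-antiderivative; thus e^1
    a1 is exact. In total degree 1 this fails, and the class of e^1 survives.\<close>
  moreover have "a1 \<in> forms_with (\<lambda>I. indices I \<subseteq> {2..} \<and> indices I \<noteq> {})"
    using a01(3) by (rule forms_with_mono) (use assms in auto)
  then have "a - a0 = diff (D1_inverse a1)"
    using a01(1) by (simp add: diff_eq D1_D1_inverse)
  then have "x = cls a0"
    unfolding a(1) using a(3) D by (subst cls_eq_iff) (auto simp: diff_eq)
  moreover have "cls ` {omega js | js. omega_index js \<and> length js = q} =
      {cls (omega js :: 'a form) | js. omega_index js \<and> length js = q}" by blast
  ultimately show "x \<in> coho.span {cls (omega js) | js. omega_index js \<and> length js = q}" by simp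
qed

text \<open>In degree 1 the inverse is the shift from e^(i-1) to e^i, so only e^2, which D_1 kills,
  is left over.\<close>

lemma sub_D1_inverse_D1_degree_1:
  assumes "a \<in> forms_with (\<lambda>I. indices I \<subseteq> {2..} \<and> card (indices I) = 1)"
  shows "a - D1_inverse (D1 a) \<in> form.span {gen 2}"
  using assms
proof (induction a rule: forms_with_induct)
  case (gens I)
  then obtain i where i: "indices I = {i}" "2 \<le> i"
    by (metis (no_types, lifting) One_nat_def atLeast_iff card_1_singletonE insert_subset)
  have "gen i - D1_inverse (D1 (gen i)) \<in> form.span {gen 2 :: 'a form}"
  proof (cases "i = 2")
    case True
    then show ?thesis by (simp add: D1_gen form.span_base)
  next
    case False
    then have "D1_inverse (gen (i - 1)) = omega_ext (one_form :: 'a form) i"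
      using D1_inverse_gens[of "[i - 1]"] i by simp
    also have "\<dots> = gen i" by (subst omega_ext_rec) simp
    finally have "D1_inverse (gen (i - 1)) = (gen i :: 'a form)" .
    then show ?thesis using False i by (simp add: D1_gen form.span_zero)
  qed
  then show ?case using i by simp
next
  case (add a b)
  then show ?case
    by (metis (no_types, lifting) D1_add D1_inverse_add add_diff_add form.span_add)
next
  case (scale c a)
  then show ?case
    by (simp add: D1_scale D1_inverse_scale form.span_scale flip: form.scale_right_diff_distrib)
qed (simp add: form.span_zero)

lemma H_1: "H 1 = (coho.span {cls (gen 1), cls (gen 2)} :: 'k::field coho set)"
proof
  show "(coho.span {cls (gen 1), cls (gen 2)} :: 'k coho set) \<subseteq> H 1"
    by (rule coho.span_minimal[OF _ subspace_H])
      (auto simp: H_def diff_gen_1 diff_gen_2 intro: Lam_gen)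
  show "(H 1 :: 'k coho set) \<subseteq> coho.span {cls (gen 1), cls (gen 2)}"
  proof
    fix x assume "x \<in> (H 1 :: 'k coho set)"
    then obtain a :: "'k form" where a: "x = cls a" "a \<in> Lam 1" "diff a = 0"
      by (auto simp: H_def)
    from a(2) obtain a0 a1 where a01: "a = a0 + gen 1 \<^bold>\<and> a1"
      "a0 \<in> forms_with (\<lambda>I. indices I \<subseteq> {2..} \<and> int (card (indices I)) = 1)"
      "a1 \<in> forms_with (\<lambda>I. indices I \<subseteq> {2..} \<and> int (card (indices I)) = 1 - 1)"
      by (rule gen_1_decomposition)
    have "a0 \<in> forms_on {2..}" using a01(2) by (rule forms_with_mono) simp
    then have D: "D1 a0 = 0" using a(3) a01(1) diff_eq_0_iff by blast
    have "a0 \<in> forms_with (\<lambda>I. indices I \<subseteq> {2..} \<and> card (indices I) = 1)"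
      using a01(2) by (rule forms_with_mono) auto
    then have "a0 \<in> form.span {gen 2}"
      using sub_D1_inverse_D1_degree_1[of a0] D by simp
    then have "a0 \<in> form.span {gen 1, gen 2}"
      using form.span_mono[of "{gen 2}" "{gen 1, gen 2}"] by blast
    \<comment> \<open>In this degree a1 is a constant, so e^1 a1 is a multiple of e^1.\<close>
    moreover have "a1 \<in> forms_with (\<lambda>I. I = Ixset {})"
      using a01(3) by (rule forms_with_mono) (auto simp: eq_Ixset_iff)
    then have "gen 1 \<^bold>\<and> a1 \<in> form.span {gen 1, gen 2}"
    proof (induction a1 rule: forms_with_induct)
      case (gens I)
      then show ?case by (simp add: form.span_base)
    qed (auto simp: wedge_add_right intro: form.span_zero form.span_add form.span_scale)
    ultimately have "a \<in> form.span {gen 1, gen 2}"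
      unfolding a01(1) by (rule form.span_add)
    then have "cls a \<in> coho.span (cls ` {gen 1, gen 2})"
      by (rule cls_span) (auto simp: diff_gen_1 diff_gen_2)
    then show "x \<in> coho.span {cls (gen 1), cls (gen 2)}" by (simp add: a(1))
  qed
qed

section \<open>Related cocycles\<close>

lemma massey_deg_split:
  assumes "i \<le> r" "r < j"
  shows "massey_deg ps i r + massey_deg ps (r + 1) j = massey_deg ps i j + 1"
proof -
  have "{i..j} = {i..r} \<union> {r + 1..j}" using assms by auto
  then have "(\<Sum>s=i..j. ps ! (s - 1) - 1) = (\<Sum>s=i..r. ps ! (s - 1) - 1) + (\<Sum>s=r + 1..j. ps ! (s - 1) - 1)"
    by (simp only:) (rule sum.union_disjoint, auto)
  then show ?thesis by (simp add: massey_deg_def)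
qed

lemma bar_Lam: "a \<in> Lam k \<Longrightarrow> bar l a \<in> Lam k"
  by (simp add: bar_def Lam_eq forms_with_neg)

lemma diff_bar: "diff (bar k a) = bar k (diff a)"
  by (simp add: bar_def diff.neg)

lemma bar_sum: "bar k (\<Sum>i\<in>S. f i) = (\<Sum>i\<in>S. bar k (f i))"
  by (induction S rule: infinite_finite_induct) (simp_all add: bar_add)

text \<open>The exponents (k + 1) + (l + 1) and l' + 1 have the same parity.\<close>

lemma bar_bar_wedge: "k + 1 = l + l' \<Longrightarrow> bar k (bar l a \<^bold>\<and> b) = a \<^bold>\<and> bar l' b"
  by (auto simp: bar_def)

context
  fixes ps :: "int list" and as :: "'k::field form list" and A :: "nat \<Rightarrow> nat \<Rightarrow> 'k form"
  assumes system: "defining_system ps as A"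
begin

lemma defining_system_Lam:
  "1 \<le> i \<Longrightarrow> i \<le> j \<Longrightarrow> j \<le> length as \<Longrightarrow> (i, j) \<noteq> (1, length as) \<Longrightarrow> A i j \<in> Lam (massey_deg ps i j)"
  using system by (auto simp: defining_system_def)

lemma defining_system_diag:
  assumes "1 \<le> i" "i \<le> length as"
  shows "A i i = as ! (i - 1)"
proof -
  have "(i, i) \<noteq> (1, length as)"
    using system by (auto simp: defining_system_def massey_arguments_def)
  then show ?thesis using system assms unfolding defining_system_def by blast
qed

lemma defining_system_diff:
  assumes "1 \<le> i" "i \<le> j" "j \<le> length as" "(i, j) \<noteq> (1, length as)"
  shows "diff (A i j) = massey_sum ps A i j"
proof (cases "i = j")
  case True
  then have "A i j = as ! (i - 1)" using defining_system_diag assms by simp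
  then have "diff (A i j) = 0"
    using system assms True by (simp add: defining_system_def massey_arguments_def)
  then show ?thesis by (simp add: massey_sum_def True)
next
  case False
  then show ?thesis using system assms by (auto simp: defining_system_def)
qed

lemma massey_sum_Lam: "massey_sum ps A 1 (length as) \<in> Lam (massey_deg ps 1 (length as) + 1)"
  unfolding massey_sum_def Lam_eq
proof (rule forms_with_sum)
  fix r assume r: "r \<in> {1..<length as}"
  then have "bar (massey_deg ps 1 r) (A 1 r) \<^bold>\<and> A (r + 1) (length as)
      \<in> Lam (massey_deg ps 1 r + massey_deg ps (r + 1) (length as))"
    by (intro Lam_wedge bar_Lam defining_system_Lam) auto
  then show "bar (massey_deg ps 1 r) (A 1 r) \<^bold>\<and> A (r + 1) (length as)
      \<in> forms_with (\<lambda>I. int (card (indices I)) = massey_deg ps 1 (length as) + 1)"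
    using massey_deg_split[of 1 r "length as" ps] r by (simp add: Lam_eq)
qed

text \<open>Every triple product a(1,r) a(r+1,s) a(s+1,n) arises twice, once from differentiating a
  left factor a(1,s) and once from a right factor a(r+1,n), with opposite signs.\<close>

lemma diff_massey_sum: "diff (massey_sum ps A 1 (length as)) = 0"
proof -
  define n where "n = length as"
  \<comment> \<open>The bar on the middle factor is what both contributions produce:
    \<open>bar_bar_wedge\<close> moves it there in the first, and \<open>massey_sum\<close> has it
    there in the second.\<close>
  define F where "F r s = A 1 r \<^bold>\<and> bar (massey_deg ps (r + 1) s) (A (r + 1) s) \<^bold>\<and> A (s + 1) n" for r s
  have "diff (bar (massey_deg ps 1 r) (A 1 r) \<^bold>\<and> A (r + 1) n) =
      (\<Sum>s | s \<in> {1..<n} \<and> s < r. F s r) - (\<Sum>s | s \<in> {1..<n} \<and> r < s. F r s)" if r: "r \<in> {1..<n}" for r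
  proof -
    have "diff (bar (massey_deg ps 1 r) (A 1 r)) = bar (massey_deg ps 1 r) (massey_sum ps A 1 r)"
      using r defining_system_diff[of 1 r] by (simp add: diff_bar n_def)
    also have "\<dots> = (\<Sum>s=1..<r. A 1 s \<^bold>\<and> bar (massey_deg ps (s + 1) r) (A (s + 1) r))"
      unfolding massey_sum_def bar_sum
      by (rule sum.cong[OF refl], rule bar_bar_wedge) (use massey_deg_split[of 1 _ r ps] in auto)
    finally have 1: "diff (bar (massey_deg ps 1 r) (A 1 r)) \<^bold>\<and> A (r + 1) n = (\<Sum>s=1..<r. F s r)"
      by (simp add: F_def wedge_sum_left wedge_assoc)
    have "diff (A (r + 1) n) = massey_sum ps A (r + 1) n"
      using r defining_system_diff[of "r + 1" n] by (simp add: n_def)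
    then have 2: "A 1 r \<^bold>\<and> diff (A (r + 1) n) = (\<Sum>s=r + 1..<n. F r s)"
      by (simp add: massey_sum_def F_def wedge_sum_right)
    have "{s. s \<in> {1..<n} \<and> s < r} = {1..<r}" "{s. s \<in> {1..<n} \<and> r < s} = {r + 1..<n}"
      using r by auto
    then show ?thesis
      using diff_bar_wedge[OF defining_system_Lam[of 1 r], of "A (r + 1) n"] r 1 2 by (simp add: n_def)
  qed
  then have "diff (massey_sum ps A 1 n) =
      (\<Sum>r=1..<n. \<Sum>s | s \<in> {1..<n} \<and> s < r. F s r) - (\<Sum>r=1..<n. \<Sum>s | s \<in> {1..<n} \<and> r < s. F r s)"
    by (simp add: massey_sum_def diff.sum sum_subtractf)
  also have "(\<Sum>r=1..<n. \<Sum>s | s \<in> {1..<n} \<and> r < s. F r s) = (\<Sum>s=1..<n. \<Sum>r | r \<in> {1..<n} \<and> r < s. F r s)"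
    by (rule sum.swap_restrict) auto
  finally show ?thesis by (simp add: n_def)
qed

end

section \<open>Degrees of related cocycles and a criterion for non-triviality\<close>

lemma massey_deg_ge_1:
  assumes "\<forall>p\<in>set ps. 1 \<le> p"
  shows "1 \<le> massey_deg ps 1 (length ps)"
proof -
  have "0 \<le> ps ! (r - 1) - 1" if "r \<in> {1..length ps}" for r
  proof -
    have "r - 1 < length ps" using that by auto
    then show ?thesis using assms nth_mem by fastforce
  qed
  then have "0 \<le> (\<Sum>r=1..length ps. ps ! (r - 1) - 1)" by (rule sum_nonneg)
  then show ?thesis by (simp add: massey_deg_def)
qed

lemma massey_subset_H:
  assumes "defining_system ps as A"
  shows "cls (massey_sum ps A 1 (length as)) \<in> H (massey_deg ps 1 (length as) + 1)"
  using massey_sum_Lam[OF assms] diff_massey_sum[OF assms] by (auto simp: H_def)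

lemma H_subset_H_pos: "q \<ge> 1 \<Longrightarrow> H q \<subseteq> H_pos"
  unfolding H_pos_def by (intro subset_trans[OF _ coho.span_superset]) auto

text \<open>Arguments of degree at least 1 give a related cocycle of degree at least 2. This makes
  \<open>H_pos\<close> itself one of the subspaces intersected in
  \<open>massey_generated\<close>.\<close>

lemma massey_closed_H_pos: "massey_closed H_pos"
  unfolding massey_closed_def
proof (intro allI impI subsetI)
  fix ps and as :: "'k::field form list" and x
  assume *: "(\<forall>p\<in>set ps. 1 \<le> p) \<and> massey_nontrivial ps as \<and> cls ` set as \<subseteq> H_pos" and "x \<in> massey ps as"
  then obtain A where A: "defining_system ps as A" "x = cls (massey_sum ps A 1 (length as))"
    by (auto simp: massey_def)
  then have "length ps = length as" by (simp add: defining_system_def massey_arguments_def)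
  then have "1 \<le> massey_deg ps 1 (length as) + 1" using massey_deg_ge_1[of ps] * by simp
  then show "x \<in> H_pos" using massey_subset_H[OF A(1)] A(2) H_subset_H_pos by blast
qed

lemma massey_nontrivialI:
  assumes "massey_defined ps as"
    and "\<And>A. defining_system ps as A \<Longrightarrow>
      \<exists>I. 1 \<notin> indices I \<and> Poly_Mapping.lookup (massey_sum ps A 1 (length as)) I \<noteq> 0"
  shows "massey_nontrivial ps as"
  unfolding massey_nontrivial_def
proof
  show "0 \<notin> massey ps as"
  proof
    assume "0 \<in> massey ps as"
    then obtain A where A: "defining_system ps as A" "cls (massey_sum ps A 1 (length as)) = 0"
      by (auto simp: massey_def)
    then obtain x where "massey_sum ps A 1 (length as) = diff x"
      using cls_eq_0_iff[OF diff_massey_sum[OF A(1)]] by blast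
    then show False using assms(2)[OF A(1)] lookup_diff by metis
  qed
qed (rule assms(1))

section \<open>Massey products $\langle e^2, e^1, \dots, e^1, c\rangle$\<close>

declare add_2_eq_Suc [simp del] add_2_eq_Suc' [simp del]

text \<open>Laplace expansion along the factor of degree 1.\<close>

lemma lookup_one_form_wedge:
  assumes "a \<in> Lam 1"
  shows "Poly_Mapping.lookup (a \<^bold>\<and> b) I =
    (\<Sum>s\<in>indices I. (- 1) ^ card {j \<in> indices I. j < s} * Poly_Mapping.lookup a (Ixset {s}) *
      Poly_Mapping.lookup b (Ixset (indices I - {s})))"
  using assms unfolding Lam_eq
proof (induction a rule: forms_with_induct)
  case (gens J)
  then obtain i where i: "indices J = {i}" by (auto simp: card_1_singleton_iff One_nat_def)
  then have "i \<ge> 1" using zero_notin_indices[of J] by (cases i) (auto simp: One_nat_def)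
  have "(\<Sum>s\<in>indices I. (- 1) ^ card {j \<in> indices I. j < s} * Poly_Mapping.lookup (gen i :: 'a form) (Ixset {s}) *
      Poly_Mapping.lookup b (Ixset (indices I - {s}))) =
     (\<Sum>s\<in>indices I. if s = i then (- 1) ^ card {j \<in> indices I. j < s} *
      Poly_Mapping.lookup b (Ixset (indices I - {s})) else 0)"
  proof (rule sum.cong[OF refl])
    fix s assume "s \<in> indices I"
    then have "0 \<notin> {s}" by (metis singletonD zero_notin_indices)
    then have "Ixset {i} = Ixset {s} \<longleftrightarrow> i = s" using \<open>i \<ge> 1\<close> by (subst Ixset_eq_iff) auto
    then show "(- 1) ^ card {j \<in> indices I. j < s} * Poly_Mapping.lookup (gen i :: 'a form) (Ixset {s}) *
      Poly_Mapping.lookup b (Ixset (indices I - {s})) = (if s = i then (- 1) ^ card {j \<in> indices I. j < s} *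
      Poly_Mapping.lookup b (Ixset (indices I - {s})) else 0)"
      using \<open>i \<ge> 1\<close> by (auto simp: gen_eq_mon lookup_single when_def)
  qed
  then show ?case using \<open>i \<ge> 1\<close> by (simp add: i lookup_gen_wedge)
qed (simp_all add: wedge_add_left lookup_add sum.distrib distrib_left distrib_right sum_distrib_left mult.left_commute mult.assoc)

abbreviation coef :: "'k::field form \<Rightarrow> nat \<Rightarrow> 'k"
  where "coef a s \<equiv> Poly_Mapping.lookup a (Ixset {s})"

lemma coef_gen: "1 \<le> i \<Longrightarrow> 1 \<le> s \<Longrightarrow> coef (gen i) s = (if i = s then 1 else 0)"
  by (simp add: gen_eq_mon lookup_single when_def Ixset_eq_iff)

lemma lookup_one_form_wedge_pair:
  fixes a b :: "'k::field form"
  assumes "a \<in> Lam 1" "1 \<le> s" "s < t"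
  shows "Poly_Mapping.lookup (a \<^bold>\<and> b) (Ixset {s, t}) = coef a s * coef b t - coef a t * coef b s"
proof -
  have "{j. (j = s \<or> j = t) \<and> j < s} = {}" "{j. (j = s \<or> j = t) \<and> j < t} = {s}"
    using assms by auto
  then have "(- 1 :: 'k) ^ card {j. (j = s \<or> j = t) \<and> j < s} = 1"
    "(- 1 :: 'k) ^ card {j. (j = s \<or> j = t) \<and> j < t} = - 1"
    by (simp_all only: card.empty) simp_all
  moreover have "{s, t} - {s} = {t}" "{s, t} - {t} = {s}" using assms by auto
  ultimately show ?thesis using assms by (simp add: lookup_one_form_wedge)
qed

lemma coef_D1: "a \<in> Lam 1 \<Longrightarrow> 2 \<le> s \<Longrightarrow> coef (D1 a) s = coef a (s + 1)"
  unfolding Lam_eq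
proof (induction a rule: forms_with_induct)
  case (gens J)
  then obtain i where i: "indices J = {i}" by (auto simp: card_1_singleton_iff One_nat_def)
  then have "i \<ge> 1" using zero_notin_indices[of J] by (cases i) (auto simp: One_nat_def)
  then show ?case using gens i by (auto simp: D1_gen coef_gen)
qed (simp_all add: D1_add D1_scale lookup_add)

text \<open>Only e^(s+1) has e^1 e^s in its differential. So a defining equation read at e^1 e^s
  determines the coefficients of index at least 3 of its unknown, while those at e^1 and e^2 remain
  free.\<close>

lemma lookup_diff_pair:
  assumes "a \<in> Lam 1" "2 \<le> s"
  shows "Poly_Mapping.lookup (diff a) (Ixset {1, s}) = coef a (s + 1)"
proof -
  have "Poly_Mapping.lookup (diff a) (Ixset {1, s}) = coef (D1 a) s"
    unfolding diff_eq using assms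
    by (subst lookup_one_form_wedge_pair[OF Lam_gen]) (auto simp: coef_gen)
  then show ?thesis using assms coef_D1 by simp
qed

text \<open>
  The Massey products \<open>\<langle>e\<^sup>2, e\<^sup>1, \<dots>, e\<^sup>1, c\<rangle>\<close> with \<open>m\<close> factors \<open>e\<^sup>1\<close> and \<open>c\<close> of degree \<open>p\<close>; the last
  position is \<open>m + 2\<close>.
\<close>

definition string_degs :: "nat \<Rightarrow> int \<Rightarrow> int list"
  where "string_degs m p = replicate (m + 1) 1 @ [p]"

definition string_args :: "nat \<Rightarrow> 'k::field form \<Rightarrow> 'k form list"
  where "string_args m c = gen 2 # replicate m (gen 1) @ [c]"

lemma length_string_args [simp]: "length (string_args m c) = m + 2"
  by (simp add: string_args_def)

lemma string_degs_nth: "i < m + 1 \<Longrightarrow> string_degs m p ! i = 1"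
  "string_degs m p ! (m + 1) = p" "string_degs m p ! Suc m = p"
  by (simp_all add: string_degs_def nth_append del: replicate_Suc)

lemma string_args_nth: "string_args m c ! 0 = gen 2"
  "1 \<le> i \<Longrightarrow> i < m + 1 \<Longrightarrow> string_args m c ! i = gen 1"
  "string_args m c ! (m + 1) = c" "string_args m c ! Suc m = c"
  by (auto simp: string_args_def nth_append nth_Cons')

lemma massey_deg_string:
  assumes "1 \<le> i"
  shows "j \<le> m + 1 \<Longrightarrow> massey_deg (string_degs m p) i j = 1"
    and "i \<le> m + 2 \<Longrightarrow> massey_deg (string_degs m p) i (m + 2) = p"
proof -
  have 0: "(\<Sum>r=i..j. string_degs m p ! (r - 1) - 1) = 0" if "j \<le> m + 1" for j
    by (rule sum.neutral) (use assms that in \<open>auto simp: string_degs_nth\<close>)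
  then show "j \<le> m + 1 \<Longrightarrow> massey_deg (string_degs m p) i j = 1" by (simp add: massey_deg_def)
  assume "i \<le> m + 2"
  then have "{i..m + 2} = insert (m + 2) {i..m + 1}" by auto
  then show "massey_deg (string_degs m p) i (m + 2) = p"
    using 0[of "m + 1"] string_degs_nth(3)[of m p] by (simp add: massey_deg_def)
qed

text \<open>All left factors in these sums have degree 1, where \<open>bar\<close> is the
  identity.\<close>

lemma massey_sum_string:
  assumes "1 \<le> i" "j \<le> m + 2"
  shows "massey_sum (string_degs m p) A i j = (\<Sum>r=i..<j. A i r \<^bold>\<and> A (r + 1) j)"
  unfolding massey_sum_def
  by (rule sum.cong[OF refl]) (use assms in \<open>simp add: massey_deg_string bar_def\<close>)

lemma massey_arguments_string:
  assumes "c \<in> Lam p" "diff c = 0"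
  shows "massey_arguments (string_degs m p) (string_args m c)"
  unfolding massey_arguments_def
proof (intro conjI allI impI)
  show "length (string_degs m p) = length (string_args m c)" by (simp add: string_degs_def)
  show "2 \<le> length (string_args m c)" by simp
next
  fix i assume "i < length (string_args m c)"
  then consider "i = 0" | "1 \<le> i" "i < m + 1" | "i = m + 1" by fastforce
  then have "string_args m c ! i \<in> Lam (string_degs m p ! i) \<and> diff (string_args m c ! i) = 0"
    by cases (use assms in \<open>auto simp: string_args_nth string_degs_nth Lam_gen diff_gen_1 diff_gen_2 simp del: add_2_eq_Suc'\<close>)
  then show "string_args m c ! i \<in> Lam (string_degs m p ! i)" "diff (string_args m c ! i) = 0" by auto
qed

text \<open>\<open>G t\<close> is meant to be a t-fold antiderivative of the last argument, so the
  bottom entry i = m + 2 gets \<open>G 0\<close>. The signs in the first row compensate e^j e^1 = -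
  e^1 e^j at each step.\<close>

definition string_system :: "nat \<Rightarrow> (nat \<Rightarrow> 'k::field form) \<Rightarrow> nat \<Rightarrow> nat \<Rightarrow> 'k form"
  where "string_system m G i j = (if j = m + 2 then G (m + 2 - i)
    else if i = 1 then (- 1) ^ (j - 1) \<cdot> gen (j + 1) else if i = j then gen 1 else 0)"

lemma massey_sum_string_system:
  "massey_sum (string_degs m p) (string_system m G) 1 (m + 2) =
    (\<Sum>r=1..<m + 2. (- 1) ^ (r - 1) \<cdot> (gen (r + 1) \<^bold>\<and> G (m + 1 - r)))"
proof -
  have "m + 2 - (r + 1) = m + 1 - r" for r by simp
  then show ?thesis
    by (subst massey_sum_string) (auto simp: string_system_def intro!: sum.cong)
qed

lemma Lam_scale: "a \<in> Lam k \<Longrightarrow> c \<cdot> a \<in> Lam k"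
  unfolding Lam_eq by (rule forms_with_scale)

lemma defining_system_string_system:
  assumes G: "\<And>t. G t \<in> Lam p" "\<And>t. diff (G (t + 1)) = gen 1 \<^bold>\<and> G t" and "diff (G 0) = 0"
  shows "defining_system (string_degs m p) (string_args m (G 0)) (string_system m G)"
  unfolding defining_system_def
proof (intro conjI allI impI massey_arguments_string)
  fix i j assume ij: "1 \<le> i \<and> i \<le> j \<and> j \<le> length (string_args m (G 0)) \<and> (i, j) \<noteq> (1, length (string_args m (G 0)))"
  then consider "j = m + 2" "2 \<le> i" | "i = 1" "j \<le> m + 1" | "2 \<le> i" "j \<le> m + 1" by fastforce
  note cases = this
  show "string_system m G i j \<in> Lam (massey_deg (string_degs m p) i j)"
    using cases
    by cases (use ij G in \<open>auto simp: massey_deg_string string_system_def Lam_gen Lam_scale,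
      simp add: Lam_def\<close>)
  show "string_system m G i j = string_args m (G 0) ! (i - 1)" if "i = j"
    using cases
    by cases (use ij that string_args_nth(4)[of m "G 0"] in \<open>auto simp: string_system_def string_args_nth\<close>)
  show "diff (string_system m G i j) = massey_sum (string_degs m p) (string_system m G) i j" if "i < j"
    using cases
  proof cases
    case 1
    have "massey_sum (string_degs m p) (string_system m G) i j =
        (\<Sum>r=i..<j. string_system m G i r \<^bold>\<and> string_system m G (r + 1) j)"
      by (rule massey_sum_string) (use 1 ij in auto)
    \<comment> \<open>Entries a(i,r) with 2 <= i < r <= m + 1 vanish, so only r = i
      survives.\<close>
    also have "\<dots> = (\<Sum>r=i..<j. if r = i then gen 1 \<^bold>\<and> G (m + 1 - i) else 0)"
      by (rule sum.cong[OF refl]) (use 1 ij in \<open>auto simp: string_system_def One_nat_def\<close>)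
    finally have "massey_sum (string_degs m p) (string_system m G) i j =
        (\<Sum>r=i..<j. if r = i then gen 1 \<^bold>\<and> G (m + 1 - i) else 0)" .
    moreover have "m + 2 - i = m + 1 - i + 1" using 1 that by simp
    ultimately show ?thesis using 1 that G(2)[of "m + 1 - i"] by (simp add: string_system_def)
  next
    case 2
    \<comment> \<open>The right factor a(r+1,j) is zero unless it lies on the diagonal, so only r =
      j - 1 survives.\<close>
    have "massey_sum (string_degs m p) (string_system m G) i j =
        (\<Sum>r=i..<j. if r = j - 1 then (- 1) ^ (j - 2) \<cdot> (gen j \<^bold>\<and> gen 1) else 0)"
    proof (subst massey_sum_string)
      show "(\<Sum>r=i..<j. string_system m G i r \<^bold>\<and> string_system m G (r + 1) j) =
          (\<Sum>r=i..<j. if r = j - 1 then (- 1) ^ (j - 2) \<cdot> (gen j \<^bold>\<and> gen 1) else 0)"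
      proof (rule sum.cong[OF refl])
        fix r assume r: "r \<in> {i..<j}"
        have "r + 1 = j \<and> r - 1 = j - 2" if "r = j - 1" using that r by auto
        then show "string_system m G i r \<^bold>\<and> string_system m G (r + 1) j =
            (if r = j - 1 then (- 1) ^ (j - 2) \<cdot> (gen j \<^bold>\<and> gen 1) else 0)"
          using r 2 by (cases "r = j - 1") (auto simp: string_system_def)
      qed
    qed (use 2 in auto)
    also have "j - 1 \<in> {i..<j}" using 2 that by auto
    then have "(\<Sum>r=i..<j. if r = j - 1 then (- 1) ^ (j - 2) \<cdot> (gen j \<^bold>\<and> gen 1) else 0) =
        ((- 1) ^ (j - 2) \<cdot> (gen j \<^bold>\<and> gen 1) :: 'a form)" by (simp add: sum.delta)
    also have "\<dots> = (- 1) ^ (j - 1) \<cdot> (gen 1 \<^bold>\<and> gen j)"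
    proof -
      have "j - 1 = Suc (j - 2)" using 2 that by simp
      then show ?thesis using gen_wedge_anticomm[of j 1, where 'a = 'a] by simp
    qed
    finally show ?thesis using 2 that by (simp add: string_system_def diff.scale diff_gen)
  next
    case 3
    \<comment> \<open>Off-diagonal entries are zero here, and for j = i + 1 the single product is
      e^1 e^1 = 0.\<close>
    have "massey_sum (string_degs m p) (string_system m G) i j = (\<Sum>r=i..<j. 0)"
      by (subst massey_sum_string) (use 3 ij that in \<open>auto simp: string_system_def intro!: sum.neutral\<close>)
    then show ?thesis using 3 that by (simp add: string_system_def diff.zero)
  qed
qed (use assms in auto)

section \<open>Coefficients forced by the defining equations\<close>

context
  fixes m :: nat and p :: int and c :: "'k::field form" and A :: "nat \<Rightarrow> nat \<Rightarrow> 'k form"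
  assumes system: "defining_system (string_degs m p) (string_args m c) A"
begin

lemma string_one_form:
  assumes "1 \<le> i" "i \<le> j" "j \<le> m + 2" "(i, j) \<noteq> (1, m + 2)" "j = m + 2 \<longrightarrow> p = 1"
  shows "A i j \<in> Lam 1"
  using defining_system_Lam[OF system, of i j] assms massey_deg_string[of i]
  by (cases "j = m + 2") auto

text \<open>The defining equation read at e^1 e^s. It needs all entries involved to be 1-forms,
  which in the last column means p = 1.\<close>

lemma string_coef_rec:
  assumes "1 \<le> i" "i \<le> j" "j \<le> m + 2" "(i, j) \<noteq> (1, m + 2)" "j = m + 2 \<longrightarrow> p = 1" "2 \<le> s"
  shows "coef (A i j) (s + 1) =
    (\<Sum>r=i..<j. coef (A i r) 1 * coef (A (r + 1) j) s - coef (A i r) s * coef (A (r + 1) j) 1)"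
proof -
  have "coef (A i j) (s + 1) = Poly_Mapping.lookup (diff (A i j)) (Ixset {1, s})"
    using lookup_diff_pair[OF string_one_form] assms by simp
  also have "diff (A i j) = (\<Sum>r=i..<j. A i r \<^bold>\<and> A (r + 1) j)"
    using defining_system_diff[OF system, of i j] assms massey_sum_string by simp
  also have "Poly_Mapping.lookup \<dots> (Ixset {1, s}) =
      (\<Sum>r=i..<j. coef (A i r) 1 * coef (A (r + 1) j) s - coef (A i r) s * coef (A (r + 1) j) 1)"
    unfolding lookup_sum
    by (rule sum.cong[OF refl], rule lookup_one_form_wedge_pair[OF string_one_form]) (use assms in auto)
  finally show ?thesis .
qed

text \<open>Each use of the recursion lowers s by one and shortens the interval by at least one. So
  s > j - i + 1 persists down to the diagonal, where e^1 has no coefficient at s >= 2.\<close>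

lemma string_coef_middle:
  assumes "2 \<le> i" "i \<le> j" "j \<le> m + 1" "2 \<le> s" "j + 1 < s + i"
  shows "coef (A i j) s = 0"
  using assms
proof (induction "j - i" arbitrary: i j s rule: less_induct)
  case less
  show ?case
  proof (cases "i = j")
    case True
    then have "A i j = gen 1"
      using defining_system_diag[OF system, of i] less.prems string_args_nth(2)[of "i - 1" m c] by simp
    then show ?thesis using less.prems by (simp add: coef_gen)
  next
    case False
    then have s: "s = s - 1 + 1" "2 \<le> s - 1" using less.prems by auto
    have "coef (A (r + 1) j) (s - 1) = 0" "coef (A i r) (s - 1) = 0" if "i \<le> r" "r < j" for r
      using less.hyps[of j "r + 1" "s - 1"] less.hyps[of r i "s - 1"] less.prems s that by auto
    then show ?thesis
      using less.prems s by (subst s(1), subst string_coef_rec) auto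
  qed
qed

text \<open>Entries between the e^1 contribute nothing at such high indices. What remains is r = j -
  1, where a(j,j) = e^1 stands on the right and costs a minus sign; the start is a(1,1) =
  e^2.\<close>

lemma string_coef_first:
  assumes "1 \<le> j" "j \<le> m + 1" "j + 1 \<le> s"
  shows "coef (A 1 j) s = (if s = j + 1 then (- 1) ^ (j - 1) else 0)"
  using assms
proof (induction j arbitrary: s rule: less_induct)
  case (less j)
  show ?case
  proof (cases "j = 1")
    case True
    then have "A 1 j = gen 2"
      using defining_system_diag[OF system, of 1] string_args_nth(1)[of m c] by simp
    then show ?thesis using less.prems True by (auto simp: coef_gen)
  next
    case False
    then have s: "s = s - 1 + 1" "2 \<le> s - 1" using less.prems by auto
    have "A j j = gen 1"
      using defining_system_diag[OF system, of j] less.prems False string_args_nth(2)[of "j - 1" m c] by simp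
    then have j: "coef (A j j) 1 = 1" by (simp add: coef_gen)
    have middle: "coef (A (r + 1) j) (s - 1) = 0" if "1 \<le> r" "r < j" for r
      using string_coef_middle[of "r + 1" j "s - 1"] less.prems s that by auto
    have first: "coef (A 1 r) (s - 1) = (if r = j - 1 \<and> s = j + 1 then (- 1) ^ (j - 2) else 0)"
      if "1 \<le> r" "r < j" for r
      using less.IH[of r "s - 1"] less.prems s that by (auto simp: diff_diff_left)
    have "coef (A 1 r) 1 * coef (A (r + 1) j) (s - 1) - coef (A 1 r) (s - 1) * coef (A (r + 1) j) 1 =
        (if r = j - 1 then - (if s = j + 1 then (- 1) ^ (j - 2) else 0) else 0)" if "r \<in> {1..<j}" for r
    proof (cases "r = j - 1")
      case True
      then have "r + 1 = j" using that by auto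
      then show ?thesis using middle[of r] first[of r] j that True by auto
    next
      case False
      then show ?thesis using middle[of r] first[of r] that by auto
    qed
    then have "coef (A 1 j) s =
        (\<Sum>r=1..<j. if r = j - 1 then - (if s = j + 1 then (- 1) ^ (j - 2) else 0) else 0)"
      using less.prems s False
      by (subst s(1), subst string_coef_rec) (auto intro!: sum.cong)
    also have "j - 1 \<in> {1..<j}" using False less.prems by auto
    then have "(\<Sum>r=1..<j. if r = j - 1 then - (if s = j + 1 then (- 1) ^ (j - 2) else 0) else 0) =
        - (if s = j + 1 then (- 1 :: 'k) ^ (j - 2) else 0)" by (simp add: sum.delta)
    also have "\<dots> = (if s = j + 1 then (- 1) ^ (j - 1) else 0)"
    proof -
      have "j - 1 = Suc (j - 2)" using False less.prems by simp
      then show ?thesis by simp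
    qed
    finally show ?thesis .
  qed
qed

text \<open>The mirror image of \<open>string_coef_first\<close>: now e^1 = a(i,i) stands on the
  left, so no sign appears.\<close>

lemma string_coef_last:
  assumes "p = 1" "c = gen 2" "2 \<le> i" "i \<le> m + 2" "m + 4 \<le> s + i"
  shows "coef (A i (m + 2)) s = (if s + i = m + 4 then 1 else 0)"
  using assms(3-)
proof (induction "m + 2 - i" arbitrary: i s rule: less_induct)
  case less
  show ?case
  proof (cases "i = m + 2")
    case True
    then have "A i i = gen 2"
      using defining_system_diag[OF system, of i] string_args_nth(4)[of m c] assms(2) by simp
    then show ?thesis using less.prems True by (auto simp: coef_gen)
  next
    case False
    then have s: "s = s - 1 + 1" "2 \<le> s - 1" using less.prems by auto
    have "A i i = gen 1"
      using defining_system_diag[OF system, of i] less.prems False string_args_nth(2)[of "i - 1" m c] by simp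
    then have i: "coef (A i i) 1 = 1" by (simp add: coef_gen)
    have middle: "coef (A i r) (s - 1) = 0" if "i \<le> r" "r < m + 2" for r
      using string_coef_middle[of i r "s - 1"] less.prems s that by auto
    have last: "coef (A (r + 1) (m + 2)) (s - 1) = (if r = i \<and> s + i = m + 4 then 1 else 0)"
      if "i \<le> r" "r < m + 2" for r
      using less.hyps[of "r + 1" "s - 1"] less.prems s that by auto
    have "coef (A i r) 1 * coef (A (r + 1) (m + 2)) (s - 1) - coef (A i r) (s - 1) * coef (A (r + 1) (m + 2)) 1 =
        (if r = i then if s + i = m + 4 then 1 else 0 else 0)" if "r \<in> {i..<m + 2}" for r
      using middle[of r] last[of r] that i by auto
    then have "coef (A i (m + 2)) s =
        (\<Sum>r=i..<m + 2. if r = i then if s + i = m + 4 then 1 else 0 else 0)"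
      using less.prems s False assms(1)
      by (subst s(1), subst string_coef_rec) (auto intro!: sum.cong)
    then show ?thesis using False less.prems by simp
  qed
qed

end

text \<open>The last factors of the summands are e^n, e^(n+1), ..., so every monomial contains an
  index at least n.\<close>

lemma lookup_omega_ext_eq_0:
  assumes "indices I \<subseteq> {..<n}"
  shows "Poly_Mapping.lookup (omega_ext \<xi> n) I = 0"
proof -
  have "omega_ext \<xi> n \<in> forms_with (\<lambda>I. \<exists>i\<in>indices I. n \<le> i)"
  proof (induction \<xi> arbitrary: n rule: omega_ext_induct)
    case (step \<xi>)
    have "\<xi> \<^bold>\<and> gen n \<in> forms_with (\<lambda>I. \<exists>i\<in>indices I. n \<le> i)"
    proof (cases "n = 0")
      case False
      show ?thesis
        by (rule forms_with_wedge[where X = "\<lambda>I. True" and Y = "\<lambda>I. indices I = {n}"])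
          (use False in \<open>auto simp: forms_with_def gen_eq_mon\<close>)
    qed (simp add: gen_def)
    moreover have "omega_ext (D1 \<xi>) (Suc n) \<in> forms_with (\<lambda>I. \<exists>i\<in>indices I. n \<le> i)"
      using step[of "Suc n"] by (rule forms_with_mono) (use Suc_leD in blast)
    ultimately show ?case by (subst omega_ext_rec) (rule forms_with_diff)
  qed simp
  then have "I \<notin> Poly_Mapping.keys (omega_ext \<xi> n)" using assms by (fastforce simp: forms_with_def)
  then show ?thesis by (simp add: in_keys_iff)
qed

text \<open>The first summand of omega is this monomial itself; all later ones contain an index
  above \<open>last is + 1\<close>.\<close>

lemma lookup_omega_leading:
  assumes "omega_index is"
  shows "Poly_Mapping.lookup (omega is :: 'k::field form) (Ixset (set is \<union> {last is + 1})) = 1"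
proof -
  obtain ks k where "is": "is = ks @ [k]"
    using assms by (cases "is" rule: rev_cases) (auto simp: omega_index_def)
  have le: "\<forall>i\<in>set is. i \<le> last is"
    using assms unfolding "is" omega_index_def by (auto simp: sorted_wrt_append less_imp_le)
  have "0 \<notin> set is" using assms by (auto simp: omega_index_def)
  have "sorted_wrt (<) (is @ [last is + 1])"
    using assms le by (auto simp: sorted_wrt_append omega_index_def less_Suc_eq_le Suc_eq_plus1[symmetric] simp del: Suc_eq_plus1)
  then have "(gens (is @ [last is + 1]) :: 'k form) = mon (Ixset (set (is @ [last is + 1])))"
    by (rule gens_sorted) (use \<open>0 \<notin> set is\<close> in auto)
  moreover have "omega is = (gens (is @ [last is + 1]) - omega_ext (D1 (gens is)) (Suc (last is + 1)) :: 'k form)"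
    unfolding omega_eq_omega_ext by (subst omega_ext_rec) (simp add: gens_append)
  moreover have "indices (Ixset (set is \<union> {last is + 1})) \<subseteq> {..<Suc (last is + 1)}"
    using \<open>0 \<notin> set is\<close> le by (auto simp: le_SucI less_Suc_eq_le)
  ultimately show ?thesis by (simp add: lookup_minus lookup_omega_ext_eq_0)
qed

lemma omega_iter_one_form: "omega_iter (Suc 0) t one_form n = gen (n + t)"
  by (induction t arbitrary: n) simp_all

text \<open>With the antiderivatives \<open>omega_iter\<close> in the last column, the related
  cocycle is the expansion of \<open>omega_ext_gen_wedge\<close> up to the sign (-1)^i. For i = 2
  there are no factors e^1 and this is the ordinary product.\<close>

lemma omega_Cons_massey:
  assumes "omega_index is" "2 \<le> i" "\<forall>j\<in>set is. i < j" and c: "c = (omega is :: 'k::field form)"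
    and p: "p = int (length is) + 1"
  shows "massey_nontrivial (string_degs (i - 2) p) (string_args (i - 2) c)"
    and "(- 1) ^ i \<cdot>\<^sub>H cls (omega (i # is)) \<in> massey (string_degs (i - 2) p) (string_args (i - 2) c)"
proof -
  define m where "m = i - 2"
  have i: "i = m + 2" using assms(2) by (simp add: m_def)
  have "is": "is \<noteq> []" "2 \<le> last is" using assms(1) omega_index_last by (auto simp: omega_index_def)
  obtain L where L: "(D1 ^^ L) (gens is :: 'k form) = 0" using D1_locally_nilpotent by blast
  define G where "G t = omega_iter L t (gens is :: 'k form) (last is + 1)" for t
  have G0: "G 0 = c" using omega_ext_eq_omega_iter[OF L] by (simp add: G_def c omega_eq_omega_ext)
  have sys: "defining_system (string_degs m p) (string_args m c) (string_system m G)"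
    unfolding G0[symmetric]
  proof (rule defining_system_string_system)
    show "G t \<in> Lam p" for t
      unfolding G_def p by (rule omega_iter_Lam[OF Lam_gens])
    show "diff (G (t + 1)) = gen 1 \<^bold>\<and> G t" for t
      using D1_omega_iter[OF L, of "last is + 1" t] "is"
      by (simp add: G_def diff_eq One_nat_def)
    show "diff (G 0) = 0" unfolding G0 c using "is" by (rule diff_omega)
  qed
  have "massey_sum (string_degs m p) (string_system m G) 1 (m + 2) =
      (\<Sum>t<i - 1. (- 1) ^ i \<cdot> (- 1) ^ t \<cdot> (gen (i - t) \<^bold>\<and> G t))"
    unfolding massey_sum_string_system
  \<comment> \<open>With t = i - 1 - r the numbers r - 1 and i + t have the same parity; this
    produces (-1)^i.\<close>
  proof (rule sum.reindex_bij_witness[of _ "\<lambda>t. i - 1 - t" "\<lambda>r. i - 1 - r"])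
    fix r assume "r \<in> {1..<m + 2}"
    then have r: "1 \<le> r" "r < i" by (auto simp: i)
    have "i + (i - 1 - r) = (r - 1) + 2 * (i - r)" using r by auto
    then have "(- 1 :: 'k) ^ (i + (i - 1 - r)) = (- 1) ^ (r - 1)"
      by (simp only: power_add power_mult) simp
    then have "(- 1 :: 'k) ^ i * (- 1) ^ (i - 1 - r) = (- 1) ^ (r - 1)"
      by (simp only: power_add)
    moreover have "i - (i - 1 - r) = r + 1" "G (i - 1 - r) = G (m + 1 - r)" using r by (auto simp: i One_nat_def)
    ultimately show "(- 1) ^ i \<cdot> (- 1) ^ (i - 1 - r) \<cdot> (gen (i - (i - 1 - r)) \<^bold>\<and> G (i - 1 - r)) =
        (- 1) ^ (r - 1) \<cdot> (gen (r + 1) \<^bold>\<and> G (m + 1 - r))"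
      by (simp only: form.scale_scale)
  qed (auto simp: i)
  also have "\<dots> = (- 1) ^ i \<cdot> omega (i # is)"
    using omega_ext_gen_wedge[OF L assms(2), of "last is + 1"] "is"
    by (simp add: omega_eq_omega_ext G_def form.scale_sum_right)
  finally have sum: "massey_sum (string_degs m p) (string_system m G) 1 (m + 2) = (- 1) ^ i \<cdot> omega (i # is)" .
  have "diff (omega (i # is) :: 'k form) = 0" using "is" by (intro diff_omega) auto
  then have "cls (massey_sum (string_degs m p) (string_system m G) 1 (length (string_args m c))) =
      (- 1) ^ i \<cdot>\<^sub>H cls (omega (i # is))"
    by (simp add: sum cls_scale)
  then show "(- 1) ^ i \<cdot>\<^sub>H cls (omega (i # is)) \<in> massey (string_degs (i - 2) p) (string_args (i - 2) c)"
    unfolding massey_def m_def[symmetric]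
    by (intro CollectI exI[of _ "string_system m G"] conjI) (simp_all only: sys)
  show "massey_nontrivial (string_degs (i - 2) p) (string_args (i - 2) c)"
    unfolding m_def[symmetric]
  proof (rule massey_nontrivialI)
    show "massey_defined (string_degs m p) (string_args m c)"
      using sys by (auto simp: massey_defined_def)
    fix A :: "nat \<Rightarrow> nat \<Rightarrow> 'k form"
    assume A: "defining_system (string_degs m p) (string_args m c) A"
    \<comment> \<open>J is the leading monomial of \<open>omega is\<close>, so adding i gives that
      of \<open>omega (i # is)\<close>.\<close>
    define J where "J = set is \<union> {last is + 1}"
    have "i < last is" using assms(3) "is" by simp
    then have J: "finite J" "\<forall>j\<in>J. i < j" using assms(3) by (auto simp: J_def)
    then have [simp]: "0 \<notin> insert i J" "i \<notin> J" "0 \<notin> J" using assms(2) by auto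
    have IJ: "indices (Ixset (insert i J)) = insert i J" using J assms(2) by (intro indices_Ixset) auto
    \<comment> \<open>a(1,r) has no e^s with s > r + 1, while all indices of the monomial are at
      least i = m + 2. So only r = m + 1, s = i contributes, and its cofactor is the leading
      coefficient of \<open>omega is\<close>.\<close>
    have zero: "Poly_Mapping.lookup (A 1 r \<^bold>\<and> A (r + 1) (m + 2)) (Ixset (insert i J)) =
        (if r = m + 1 then (- 1) ^ m else 0)" if r: "r \<in> {1..<m + 2}" for r
    proof -
      have "A 1 r \<in> Lam 1" using string_one_form[OF A, of 1 r] r by auto
      then have "Poly_Mapping.lookup (A 1 r \<^bold>\<and> A (r + 1) (m + 2)) (Ixset (insert i J)) =
        (\<Sum>s\<in>insert i J. (- 1) ^ card {j \<in> insert i J. j < s} * coef (A 1 r) s *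
            Poly_Mapping.lookup (A (r + 1) (m + 2)) (Ixset (insert i J - {s})))"
        by (simp only: lookup_one_form_wedge IJ)
      also have "\<dots> = (\<Sum>s\<in>insert i J. if s = i then if r = m + 1 then (- 1) ^ m else 0 else 0)"
      proof (rule sum.cong[OF refl])
        fix s assume s: "s \<in> insert i J"
        then have "r + 1 \<le> s" "i \<le> s" using r J i by auto
        then have coef: "coef (A 1 r) s = (if s = r + 1 then (- 1) ^ (r - 1) else 0)"
          using string_coef_first[OF A, of r s] r by auto
        show "(- 1) ^ card {j \<in> insert i J. j < s} * coef (A 1 r) s *
            Poly_Mapping.lookup (A (r + 1) (m + 2)) (Ixset (insert i J - {s})) =
            (if s = i then if r = m + 1 then (- 1) ^ m else 0 else 0)"
        proof (cases "s = i \<and> r = m + 1")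
          case True
          have "{j \<in> insert i J. j < i} = {}" using J by auto
          then have "card {j \<in> insert i J. j < s} = 0" using True by (simp only: card.empty)
          moreover have "A (m + 2) (m + 2) = omega is"
            using defining_system_diag[OF A, of "m + 2"] string_args_nth(4)[of m c] c by simp
          moreover have "r + 1 = m + 2" using True by simp
          ultimately have "(- 1 :: 'k) ^ card {j \<in> insert i J. j < s} = 1" "A (r + 1) (m + 2) = omega is"
            by (simp_all only: power_0)
          moreover have "insert i J - {s} = J" using True by simp
          moreover have "Poly_Mapping.lookup (omega is :: 'k form) (Ixset J) = 1"
            unfolding J_def by (rule lookup_omega_leading[OF assms(1)])
          ultimately show ?thesis using True coef i by (simp only:) simp
        next
          case False
          then have "s \<noteq> r + 1" using r i \<open>i \<le> s\<close> by auto
          then show ?thesis using coef False by simp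
        qed
      qed
      also have "\<dots> = (if r = m + 1 then (- 1) ^ m else 0)" using J by simp
      finally show ?thesis .
    qed
    have "Poly_Mapping.lookup (massey_sum (string_degs m p) A 1 (m + 2)) (Ixset (insert i J)) = (- 1) ^ m"
      by (subst massey_sum_string) (simp_all add: lookup_sum zero)
    moreover have "1 \<notin> indices (Ixset (insert i J))" using J assms(2) by auto
    ultimately show "\<exists>I. 1 \<notin> indices I \<and>
        Poly_Mapping.lookup (massey_sum (string_degs m p) A 1 (length (string_args m c))) I \<noteq> 0"
      by (intro exI[of _ "Ixset (insert i J)"]) simp
  qed
qed

text \<open>Since D_1 e^2 = 0, the factor e^2 passes through every power of D_1.\<close>

lemma omega_gen_2_wedge:
  assumes "is \<noteq> []"
  shows "omega (2 # is) = gen 2 \<^bold>\<and> omega is"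
proof -
  have "omega_ext (gen 2 \<^bold>\<and> \<xi>) n = gen 2 \<^bold>\<and> omega_ext \<xi> n" for \<xi> :: "'a form" and n
  proof (induction \<xi> arbitrary: n rule: omega_ext_induct)
    case (step \<xi>)
    show ?case
      by (subst (1 2) omega_ext_rec)
        (simp add: D1_wedge D1_gen step wedge_assoc wedge_add_right diff_conv_add_uminus del: add_uminus_conv_diff)
  qed simp
  then show ?thesis using assms by (simp add: omega_eq_omega_ext)
qed

text \<open>The cocycle is the sum of (-1)^(r-1) e^(r+1) e^(2k-r) over 1 <= r <= 2k - 2. Replacing r
  by 2k - 1 - r changes the position sign and swaps the factors, so both halves equal (-1)^k
  omega(e^k e^(k+1)). This sign is forced: every defining system gives the coefficient 2 (-1)^k at
  e^k e^(k+1).\<close>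

lemma omega_single_massey:
  assumes "2 \<le> k"
  shows "massey_nontrivial (string_degs (2 * k - 3) 1) (string_args (2 * k - 3) (gen 2 :: 'k::field_char_0 form))"
    and "((- 1) ^ k * 2) \<cdot>\<^sub>H cls (omega [k]) \<in> massey (string_degs (2 * k - 3) 1) (string_args (2 * k - 3) (gen 2 :: 'k form))"
proof -
  define m where "m = 2 * k - 3"
  have m: "m + 3 = 2 * k" using assms by (simp add: m_def)
  define G where "G t = (gen (t + 2) :: 'k form)" for t
  have sys: "defining_system (string_degs m 1) (string_args m (gen 2)) (string_system m G)"
  proof -
    have "t + 1 + 2 - 1 = t + 2" for t :: nat by simp
    then have "defining_system (string_degs m 1) (string_args m (G 0)) (string_system m G)"
      by (intro defining_system_string_system)
        (simp_all add: G_def Lam_gen diff_gen_2 diff_gen add.commute)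
    then show ?thesis by (simp add: G_def)
  qed
  define f where "f t = (- 1 :: 'k) ^ t \<cdot> (gen (k - t) \<^bold>\<and> gen (k + 1 + t))" for t
  have omega: "omega [k] = (\<Sum>t<k - 1. f t)"
    using omega_ext_gen_wedge[of "Suc 0" "one_form :: 'k form" k "k + 1"] assms
    by (simp add: omega_eq_omega_ext omega_iter_one_form f_def)
  have scaled: "(\<Sum>t<k - 1. (- 1) ^ k \<cdot> f t) = (- 1) ^ k \<cdot> omega [k]"
    unfolding omega by (rule form.scale_sum_right[symmetric])
  have "massey_sum (string_degs m 1) (string_system m G) 1 (m + 2) =
      (\<Sum>r=1..<m + 2. (- 1) ^ (r - 1) \<cdot> (gen (r + 1) \<^bold>\<and> gen (m + 3 - r)))"
    unfolding massey_sum_string_system by (rule sum.cong) (auto simp: G_def add.commute)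
  \<comment> \<open>The halves r < k and r >= k are matched with the expansion of omega by r = k - 1
    - t and r = k + t.\<close>
  also have "{1..<m + 2} = {1..<k} \<union> {k..<m + 2}" using m assms by auto
  also have "(\<Sum>r\<in>\<dots>. (- 1 :: 'k) ^ (r - 1) \<cdot> (gen (r + 1) \<^bold>\<and> gen (m + 3 - r))) =
      (\<Sum>r=1..<k. (- 1) ^ (r - 1) \<cdot> (gen (r + 1) \<^bold>\<and> gen (m + 3 - r))) +
      (\<Sum>r=k..<m + 2. (- 1) ^ (r - 1) \<cdot> (gen (r + 1) \<^bold>\<and> gen (m + 3 - r)))"
    by (rule sum.union_disjoint) auto
  also have "(\<Sum>r=1..<k. (- 1 :: 'k) ^ (r - 1) \<cdot> (gen (r + 1) \<^bold>\<and> gen (m + 3 - r))) = (\<Sum>t<k - 1. (- 1) ^ k \<cdot> f t)"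
  proof (rule sum.reindex_bij_witness[of _ "\<lambda>t. k - 1 - t" "\<lambda>r. k - 1 - r"])
    fix r assume r: "r \<in> {1..<k}"
    then have "k + (k - 1 - r) = (r - 1) + 2 * (k - r)" by auto
    then have "(- 1 :: 'k) ^ (k + (k - 1 - r)) = (- 1) ^ (r - 1)"
      by (simp only: power_add power_mult) simp
    then have "(- 1 :: 'k) ^ k * (- 1) ^ (k - 1 - r) = (- 1) ^ (r - 1)"
      by (simp only: power_add)
    moreover have "k - (k - 1 - r) = r + 1" "k + 1 + (k - 1 - r) = m + 3 - r" using r m by auto
    ultimately show "(- 1) ^ k \<cdot> f (k - 1 - r) = (- 1) ^ (r - 1) \<cdot> (gen (r + 1) \<^bold>\<and> gen (m + 3 - r))"
      by (simp only: f_def form.scale_scale)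
  qed auto
  also have "(\<Sum>r=k..<m + 2. (- 1 :: 'k) ^ (r - 1) \<cdot> (gen (r + 1) \<^bold>\<and> gen (m + 3 - r))) = (\<Sum>t<k - 1. (- 1) ^ k \<cdot> f t)"
  proof (rule sum.reindex_bij_witness[of _ "\<lambda>t. k + t" "\<lambda>r. r - k"])
    fix r assume r: "r \<in> {k..<m + 2}"
    then have "k + (r - k) = Suc (r - 1)" using assms by auto
    then have "(- 1 :: 'k) ^ k * (- 1) ^ (r - k) = - ((- 1) ^ (r - 1))"
      by (simp only: flip: power_add) simp
    moreover have "k - (r - k) = m + 3 - r" "k + 1 + (r - k) = r + 1" using r m by auto
    ultimately show "(- 1) ^ k \<cdot> f (r - k) = (- 1) ^ (r - 1) \<cdot> (gen (r + 1) \<^bold>\<and> gen (m + 3 - r))"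
      using gen_wedge_anticomm[of "r + 1" "m + 3 - r", where 'a = 'k]
      by (simp only: f_def form.scale_scale) simp
  qed (use m in auto)
  also have "(\<Sum>t<k - 1. (- 1) ^ k \<cdot> f t) + (\<Sum>t<k - 1. (- 1) ^ k \<cdot> f t) = ((- 1) ^ k * 2) \<cdot> omega [k]"
    by (simp only: mult_2_right form.scale_left_distrib scaled)
  finally have sum: "massey_sum (string_degs m 1) (string_system m G) 1 (m + 2) = ((- 1) ^ k * 2) \<cdot> omega [k]" .
  have "diff (omega [k] :: 'k form) = 0" using assms by (intro diff_omega) auto
  then have "cls (massey_sum (string_degs m 1) (string_system m G) 1 (length (string_args m (gen 2 :: 'k form)))) =
      ((- 1) ^ k * 2) \<cdot>\<^sub>H cls (omega [k])"
    by (simp only: length_string_args sum cls_scale)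
  then show "((- 1) ^ k * 2) \<cdot>\<^sub>H cls (omega [k]) \<in> massey (string_degs (2 * k - 3) 1) (string_args (2 * k - 3) (gen 2 :: 'k form))"
    unfolding massey_def m_def[symmetric]
    by (intro CollectI exI[of _ "string_system m G"] conjI) (simp_all only: sys)
  show "massey_nontrivial (string_degs (2 * k - 3) 1) (string_args (2 * k - 3) (gen 2 :: 'k form))"
    unfolding m_def[symmetric]
  proof (rule massey_nontrivialI)
    show "massey_defined (string_degs m 1) (string_args m (gen 2 :: 'k form))"
      using sys by (auto simp: massey_defined_def)
    fix A :: "nat \<Rightarrow> nat \<Rightarrow> 'k form"
    assume A: "defining_system (string_degs m 1) (string_args m (gen 2)) A"
    \<comment> \<open>For r < k - 1 the first factor has no e^k or e^(k+1), for r > k the second has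
      none. The two remaining values of r give (-1)^k each, and their sum is nonzero in
      characteristic zero.\<close>
    have "Poly_Mapping.lookup (A 1 r \<^bold>\<and> A (r + 1) (m + 2)) (Ixset {k, k + 1}) =
        (if r = k - 1 then (- 1) ^ k else 0) + (if r = k then (- 1) ^ k else 0)" if r: "r \<in> {1..<m + 2}" for r
    proof -
      have "A 1 r \<in> Lam 1" using string_one_form[OF A, of 1 r] r by auto
      then have *: "Poly_Mapping.lookup (A 1 r \<^bold>\<and> A (r + 1) (m + 2)) (Ixset {k, k + 1}) =
          coef (A 1 r) k * coef (A (r + 1) (m + 2)) (k + 1) - coef (A 1 r) (k + 1) * coef (A (r + 1) (m + 2)) k"
        using assms by (intro lookup_one_form_wedge_pair) auto
      have first: "coef (A 1 r) s = (if s = r + 1 then (- 1) ^ (r - 1) else 0)" if "r + 1 \<le> s" for s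
        using string_coef_first[OF A, of r s] r that by auto
      have last: "coef (A (r + 1) (m + 2)) s = (if s + r = 2 * k then 1 else 0)" if "2 * k \<le> s + r" for s
        using string_coef_last[OF A refl refl, of "r + 1" s] r that m by auto
      consider "r + 1 < k" | "r = k - 1" | "r = k" | "k < r" by linarith
      then show ?thesis
      proof cases
        case 1
        then have "coef (A 1 r) k = 0" "coef (A 1 r) (k + 1) = 0" by (simp_all add: first)
        then show ?thesis using 1 unfolding * by simp
      next
        case 2
        have "k = (r - 1) + 2" using 2 r by auto
        then have "(- 1 :: 'k) ^ k = (- 1) ^ (r - 1)" by (simp only: power_add) simp
        moreover have "k = r + 1" "k + 1 + r = 2 * k" "r \<noteq> k" using 2 assms by auto
        then have "coef (A 1 r) k = (- 1) ^ (r - 1)" "coef (A 1 r) (k + 1) = 0"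
          "coef (A (r + 1) (m + 2)) (k + 1) = 1"
          using first[of k] first[of "k + 1"] last[of "k + 1"] by simp_all
        ultimately show ?thesis using 2 \<open>r \<noteq> k\<close> unfolding * by (simp only: if_True if_False refl) simp
      next
        case 3
        then have "k = Suc (r - 1)" using assms by simp
        then have "(- 1 :: 'k) ^ k = - ((- 1) ^ (r - 1))" by (simp only: power_Suc) simp
        moreover have "r \<noteq> k - 1" using 3 assms by auto
        moreover have "coef (A 1 r) (k + 1) = (- 1) ^ (r - 1)"
          "coef (A (r + 1) (m + 2)) (k + 1) = 0" "coef (A (r + 1) (m + 2)) k = 1"
          using 3 first[of "k + 1"] last[of "k + 1"] last[of k] by simp_all
        ultimately show ?thesis using 3 unfolding * by (simp only: if_True if_False refl) simp
      next
        case 4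
        then have "coef (A (r + 1) (m + 2)) k = 0" "coef (A (r + 1) (m + 2)) (k + 1) = 0"
          using last[of k] last[of "k + 1"] by simp_all
        then show ?thesis using 4 unfolding * by simp
      qed
    qed
    then have "Poly_Mapping.lookup (massey_sum (string_degs m 1) A 1 (m + 2)) (Ixset {k, k + 1}) =
        (\<Sum>r=1..<m + 2. (if r = k - 1 then (- 1) ^ k else 0) + (if r = k then (- 1) ^ k else 0))"
      by (subst massey_sum_string) (simp_all add: lookup_sum)
    also have "\<dots> = 2 * (- 1) ^ k"
    proof -
      have "k - 1 \<in> {1..<m + 2}" "k \<in> {1..<m + 2}" using m assms by auto
      then show ?thesis by (simp add: sum.distrib)
    qed
    finally show "\<exists>I. 1 \<notin> indices I \<and> Poly_Mapping.lookup
        (massey_sum (string_degs m 1) A 1 (length (string_args m (gen 2 :: 'k form)))) I \<noteq> 0"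
      using assms by (intro exI[of _ "Ixset {k, k + 1}"]) auto
  qed
qed

section \<open>Generation by the classes of degree 1\<close>

lemma massey_closedD:
  assumes "massey_closed S" "massey_nontrivial ps as" "\<forall>p\<in>set ps. 1 \<le> p" "cls ` set as \<subseteq> S" "x \<in> massey ps as"
  shows "x \<in> S"
  using assms unfolding massey_closed_def by blast

text \<open>Induction peels off the smallest index: one index is reached from e^1 and e^2 alone, and
  each further index i is attached by a product whose last argument is already in S. The scalars are
  invertible, so S contains the class itself.\<close>

lemma omega_in_massey_closed:
  fixes S :: "'k::field_char_0 coho set"
  assumes "massey_closed S" "coho.subspace S" "cls (gen 1) \<in> S" "cls (gen 2) \<in> S" "omega_index is"
  shows "cls (omega is) \<in> S"
  using assms(5)
proof (induction "is")
  case Nil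
  then show ?case by (simp add: omega_index_def)
next
  case (Cons i "is")
  have scaled: "x \<in> S" if "c \<cdot>\<^sub>H x \<in> S" "c \<noteq> 0" for c x
    using coho.subspace_scale[OF assms(2) that(1), of "inverse c"] that(2) by simp
  have args: "cls ` set (string_args m c) \<subseteq> S" if "cls c \<in> S" for m and c :: "'k form"
    using that assms by (auto simp: string_args_def)
  have degs: "\<forall>p\<in>set (string_degs m p). 1 \<le> p" if "1 \<le> p" for m p
    using that by (auto simp: string_degs_def)
  have "2 \<le> i" using Cons.prems by (simp add: omega_index_def)
  show ?case
  proof (cases "is = []")
    case True
    have "((- 1) ^ i * 2) \<cdot>\<^sub>H cls (omega [i]) \<in> S"
      by (rule massey_closedD[OF assms(1) omega_single_massey(1)[OF \<open>2 \<le> i\<close>] degs args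
            omega_single_massey(2)[OF \<open>2 \<le> i\<close>]]) (simp_all add: assms)
    then show ?thesis using True scaled by force
  next
    case False
    then have index: "omega_index is" "\<forall>j\<in>set is. i < j" using Cons.prems by (auto simp: omega_index_def)
    have "(- 1) ^ i \<cdot>\<^sub>H cls (omega (i # is)) \<in> S"
      by (rule massey_closedD[OF assms(1) omega_Cons_massey(1)[OF index(1) \<open>2 \<le> i\<close> index(2) refl refl] degs args
            omega_Cons_massey(2)[OF index(1) \<open>2 \<le> i\<close> index(2) refl refl]]) (simp_all add: Cons.IH index(1))
    then show ?thesis using scaled by force
  qed
qed

lemma massey_generated_H_1: "massey_generated (H 1) = (H_pos :: 'k::field_char_0 coho set)"
proof
  show "massey_generated (H 1) \<subseteq> (H_pos :: 'k coho set)"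
    unfolding massey_generated_def
    by (rule Inter_lower) (use massey_closed_H_pos H_subset_H_pos[of 1] in \<open>auto simp: H_pos_def\<close>)
  show "(H_pos :: 'k coho set) \<subseteq> massey_generated (H 1)"
    unfolding massey_generated_def
  proof (rule Inter_greatest)
    fix S :: "'k coho set"
    assume "S \<in> {S. coho.subspace S \<and> S \<subseteq> H_pos \<and> H 1 \<subseteq> S \<and> massey_closed S}"
    then have S: "coho.subspace S" "H 1 \<subseteq> S" "massey_closed S" by auto
    then have gens: "cls (gen 1) \<in> S" "cls (gen 2) \<in> S"
      unfolding H_1 by (auto intro: coho.span_base)
    have "H q \<subseteq> S" if "q \<ge> 1" for q
    proof (cases "q = 1")
      case False
      define q' where "q' = nat (q - 1)"
      have q: "q = int q' + 1" "q' \<ge> 1" using that False by (auto simp: q'_def)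
      have "coho.span {cls (omega js) | js. omega_index js \<and> length js = q'} \<subseteq> S"
        by (rule coho.span_minimal) (use omega_in_massey_closed[OF S(3,1) gens] S(1) in auto)
      then show ?thesis using H_subset_span_omega[OF q(2)] q(1) by blast
    qed (use S in simp)
    then show "H_pos \<subseteq> S" unfolding H_pos_def by (intro coho.span_minimal S(1)) auto
  qed
qed

lemma string_degs_args_2:
  "string_degs 0 p = [1, p]" "string_args 0 c = [gen 2, c]"
  by (simp_all add: string_degs_def string_args_def One_nat_def)

theorem theorem5p7:
  shows "(H 1 :: 'k::field_char_0 coho set) = coho.span {cls (gen 1), cls (gen 2)} \<and>
    massey_generated (H 1) = (H_pos :: 'k coho set) \<and>
    (\<forall>q is. 2 \<le> q \<and> length is = q - 1 \<and> sorted_wrt (<) is \<and> (\<forall>i\<in>set is. 2 < i) \<longrightarrow>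
       (omega (2 # is) :: 'k form) = gen 2 \<^bold>\<and> omega is \<and>
       massey_nontrivial [1, int q] [gen 2 :: 'k form, omega is]) \<and>
    (\<forall>k\<ge>2.
       let ps = replicate (2 * k - 1) 1;
           as = [gen 2 :: 'k form] @ replicate (2 * k - 3) (gen 1) @ [gen 2]
       in massey_nontrivial ps as \<and>
          ((- 1) ^ k * 2) \<cdot>\<^sub>H cls (omega [k]) \<in> massey ps as) \<and>
    (\<forall>q i is. 2 \<le> q \<and> length is = q - 1 \<and> sorted_wrt (<) (i # is) \<and> 2 \<le> i \<longrightarrow>
       (let ps = [1] @ replicate (i - 2) 1 @ [int q];
            as = [gen 2 :: 'k form] @ replicate (i - 2) (gen 1) @ [omega is]
        in massey_nontrivial ps as \<and>
           (- 1) ^ i \<cdot>\<^sub>H cls (omega (i # is)) \<in> massey ps as))"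
proof (intro conjI allI impI)
  show "(H 1 :: 'k coho set) = coho.span {cls (gen 1), cls (gen 2)}" by (rule H_1)
  show "massey_generated (H 1) = (H_pos :: 'k coho set)" by (rule massey_generated_H_1)
next
  fix q :: nat and js :: "nat list"
  assume *: "2 \<le> q \<and> length js = q - 1 \<and> sorted_wrt (<) js \<and> (\<forall>i\<in>set js. 2 < i)"
  then have js: "omega_index js" "js \<noteq> []" by (auto simp: omega_index_def)
  then show "(omega (2 # js) :: 'k form) = gen 2 \<^bold>\<and> omega js" by (intro omega_gen_2_wedge)
  have "int q = int (length js) + 1" using * by simp
  then show "massey_nontrivial [1, int q] [gen 2 :: 'k form, omega js]"
    \<comment> \<open>The case i = 2 of the general product, with an empty block of factors
      e^1.\<close>
    using omega_Cons_massey(1)[OF js(1) order_refl _ refl, of "int q"] * by (simp add: string_degs_args_2)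
next
  fix k :: nat assume k: "2 \<le> k"
  have "replicate (2 * k - 1) 1 = string_degs (2 * k - 3) 1"
  proof -
    have "2 * k - 1 = Suc (2 * k - 3 + 1)" using k by simp
    then show ?thesis by (simp only: string_degs_def replicate_append_same replicate_Suc)
  qed
  then show "let ps = replicate (2 * k - 1) 1;
           as = [gen 2 :: 'k form] @ replicate (2 * k - 3) (gen 1) @ [gen 2]
       in massey_nontrivial ps as \<and>
          ((- 1) ^ k * 2) \<cdot>\<^sub>H cls (omega [k]) \<in> massey ps as"
    using omega_single_massey[OF k, where 'k = 'k] by (simp add: string_args_def Let_def)
next
  fix q i :: nat and js :: "nat list"
  assume *: "2 \<le> q \<and> length js = q - 1 \<and> sorted_wrt (<) (i # js) \<and> 2 \<le> i"
  then have js: "omega_index js" "\<forall>j\<in>set js. i < j" "2 \<le> i"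
    by (auto simp: omega_index_def)
  have "int q = int (length js) + 1" using * by simp
  moreover have "[1] @ replicate (i - 2) 1 @ [int q] = string_degs (i - 2) (int q)"
    by (simp add: string_degs_def One_nat_def)
  ultimately show "let ps = [1] @ replicate (i - 2) 1 @ [int q];
            as = [gen 2 :: 'k form] @ replicate (i - 2) (gen 1) @ [omega js]
        in massey_nontrivial ps as \<and>
           (- 1) ^ i \<cdot>\<^sub>H cls (omega (i # js)) \<in> massey ps as"
    using omega_Cons_massey[OF js(1,3,2) refl, where 'k = 'k] by (simp add: string_args_def Let_def)
qed

end
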